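(* Let $\mathcal H$ be a separable complex Hilbert space and let $\Phi$ be an arbitrary symmetric norming function equivalent to the maximal symmetric norming function. If $T\in(\mathcal B(\mathcal H),\|\cdot\|_{\Phi^*})$ is a compact operator, then $T\in\mathcal{AN}_{\Phi^*}(\mathcal H)$, i.e. $T$ is absolutely $\Phi^*$-norming.
   Context: Let $c_{00}$ be the space of finitely supported real sequences. A symmetric norming (s.n.) function is a norm $\Phi:c_{00}\to[0,\infty)$ with $\Phi(1,0,0,\dots)=1$ that is invariant under permuting the entries and under replacing entries by their absolute values. It is determined by its values on the cone $c_{00}^*$ of nonincreasing nonnegative sequences in $c_{00}$. The maximal s.n. function is $\Phi_1(\xi)=\sum_j|\xi_j|$. Two s.n. functions $\Phi,\Psi$ are equivalent if $\sup_{\xi\neq0}\Phi(\xi)/\Psi(\xi)<\infty$ and $\sup_{\xi\ne0}\Psi(\xi)/\Phi(\xi)<\infty$. The adjoint $\Phi^*$ of $\Phi$ is the s.n. function given on $c_{00}^*$ by $\Phi^*(\eta)=\max\{\sum_j\eta_j\xi_j:\xi\in c_{00}^*,\ \Phi(\xi)=1\}$. Let $\mathcal B_1(\mathcal H)$ be the trace class operators on $\mathcal H$, and $s_1(K)\ge s_2(K)\ge\dots$ the singular values of a compact operator $K$ (counted with multiplicity). If $\Phi$ is an s.n. function equivalent to $\Phi_1$, then for $K\in\mathcal B_1(\mathcal H)$ put $\|K\|_\Phi=\Phi(s_1(K),s_2(K),\dots):=\lim_n\Phi(s_1(K),\dots,s_n(K),0,0,\dots)$. The norm $\|\cdot\|_{\Phi^*}$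 on $\mathcal B(\mathcal H)$ is the dual norm $$\|T\|_{\Phi^*}=\sup\{|\mathrm{Tr}(TK)|:K\in\mathcal B_1(\mathcal H),\ \|K\|_\Phi\le1\}.$$ An operator $T\in\mathcal B(\mathcal H)$ is $\Phi^*$-norming if there is $K\in\mathcal B_1(\mathcal H)$ with $\|K\|_\Phi=1$ and $|\mathrm{Tr}(TK)|=\|T\|_{\Phi^*}$. $T$ is absolutely $\Phi^*$-norming, written $T\in\mathcal{AN}_{\Phi^*}(\mathcal H)$, if for every nontrivial (nonzero; $\mathcal M=\mathcal H$ allowed) closed subspace $\mathcal M\subseteq\mathcal H$ the operator $TP_{\mathcal M}\in\mathcal B(\mathcal H)$ is $\Phi^*$-norming, where $P_{\mathcal M}$ is the orthogonal projection of $\mathcal H$ onto $\mathcal M$. *)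

theory Defs
  imports "HOL-Analysis.Analysis"
begin

class complex_vector = real_vector +
  fixes scaleC :: "complex \<Rightarrow> 'a \<Rightarrow> 'a" (infixr \<open>*\<^sub>C\<close> 75)
  assumes scaleC_add_right: "c *\<^sub>C (x + y) = c *\<^sub>C x + c *\<^sub>C y"
    and scaleC_add_left: "(c + d) *\<^sub>C x = c *\<^sub>C x + d *\<^sub>C x"
    and scaleC_scaleC: "c *\<^sub>C (d *\<^sub>C x) = (c * d) *\<^sub>C x"
    and scaleC_one: "1 *\<^sub>C x = x"
    and scaleR_scaleC: "r *\<^sub>R x = complex_of_real r *\<^sub>C x"

class complex_inner = complex_vector + real_normed_vector +
  fixes cinner :: "'a \<Rightarrow> 'a \<Rightarrow> complex"
  assumes cinner_commute: "cinner x y = cnj (cinner y x)"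
    and cinner_add_left: "cinner (x + y) z = cinner x z + cinner y z"
    and cinner_scaleC_left: "cinner (c *\<^sub>C x) y = c * cinner x y"
    and cinner_ge_zero: "0 \<le> Re (cinner x x)"
    and cinner_eq_zero_iff: "cinner x x = 0 \<longleftrightarrow> x = 0"
    and norm_eq_sqrt_cinner: "norm x = sqrt (Re (cinner x x))"

class chilbert_space = complex_inner + complete_space

global_interpretation complex_vector:
  vector_space "scaleC :: complex \<Rightarrow> 'a \<Rightarrow> 'a::complex_vector"
  by unfold_locales
    (simp_all add: scaleC_add_right scaleC_add_left scaleC_scaleC scaleC_one)

definition bounded_clinear :: "('a::complex_inner \<Rightarrow> 'a) \<Rightarrow> bool" where
  "bounded_clinear T \<longleftrightarrow> bounded_linear T \<and> (\<forall>c x. T (c *\<^sub>C x) = c *\<^sub>C T x)"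

definition compact_operator :: "('a::complex_inner \<Rightarrow> 'a) \<Rightarrow> bool" where
  "compact_operator T \<longleftrightarrow> bounded_clinear T \<and> compact (closure (T ` cball 0 1))"

definition cadjoint :: "('a::chilbert_space \<Rightarrow> 'a) \<Rightarrow> 'a \<Rightarrow> 'a" where
  "cadjoint T = (THE S. \<forall>x y. cinner (T x) y = cinner x (S y))"

definition cprojection :: "'a::chilbert_space set \<Rightarrow> 'a \<Rightarrow> 'a" where
  "cprojection M x = (THE y. y \<in> M \<and> (\<forall>z\<in>M. cinner (x - y) z = 0))"

definition orthonormal_basis :: "'a::chilbert_space set \<Rightarrow> bool" where
  "orthonormal_basis B \<longleftrightarrow>
     (\<forall>x\<in>B. \<forall>y\<in>B. cinner x y = (if x = y then 1 else 0)) \<and>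
     closure (complex_vector.span B) = UNIV"

text \<open>
  The singular values of a compact operator \<open>K\<close> are the square roots of the eigenvalues of
  \<open>K\<^sup>* K\<close> in nonincreasing order, repeated according to multiplicity.  Only the positive
  values are constrained by their multiplicity: there are infinitely many of them, in which case
  they fill the whole sequence, or finitely many, in which case the sequence continues with
  zeros (whatever the dimension of the kernel).  Indexing starts at 0, so \<open>s_j(K)\<close> is
  \<open>singular_value K (j - 1)\<close>.
\<close>

definition singular_value :: "('a::chilbert_space \<Rightarrow> 'a) \<Rightarrow> nat \<Rightarrow> real" where
  "singular_value K = (THE s. antimono s \<and> s \<longlonglongrightarrow> 0 \<and>
     (\<forall>t>0. card {j. s j = t} =
        complex_vector.dim {x. cadjoint K (K x) = complex_of_real (t\<^sup>2) *\<^sub>C x}))"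

definition trace_class :: "('a::chilbert_space \<Rightarrow> 'a) \<Rightarrow> bool" where
  "trace_class K \<longleftrightarrow> compact_operator K \<and> summable (singular_value K)"

definition ctrace :: "('a::chilbert_space \<Rightarrow> 'a) \<Rightarrow> complex" where
  "ctrace A = (THE c. \<forall>B. orthonormal_basis B \<longrightarrow> ((\<lambda>e. cinner (A e) e) has_sum c) B)"

definition c00 :: "(nat \<Rightarrow> real) set" where
  "c00 = {\<xi>. finite {j. \<xi> j \<noteq> 0}}"

text \<open>A function on \<open>c00\<close> is a function on all sequences whose values outside \<open>c00\<close> are
  irrelevant.\<close>

definition sn_function :: "((nat \<Rightarrow> real) \<Rightarrow> real) \<Rightarrow> bool" where
  "sn_function \<Phi> \<longleftrightarrow>
     (\<forall>\<xi>\<in>c00. 0 \<le> \<Phi> \<xi>) \<and>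
     (\<forall>\<xi>\<in>c00. \<Phi> \<xi> = 0 \<longleftrightarrow> \<xi> = (\<lambda>_. 0)) \<and>
     (\<forall>\<xi>\<in>c00. \<forall>c. \<Phi> (\<lambda>j. c * \<xi> j) = \<bar>c\<bar> * \<Phi> \<xi>) \<and>
     (\<forall>\<xi>\<in>c00. \<forall>\<eta>\<in>c00. \<Phi> (\<lambda>j. \<xi> j + \<eta> j) \<le> \<Phi> \<xi> + \<Phi> \<eta>) \<and>
     \<Phi> (\<lambda>j. if j = 0 then 1 else 0) = 1 \<and>
     (\<forall>\<xi>\<in>c00. \<forall>\<pi>. bij \<pi> \<longrightarrow> \<Phi> (\<lambda>j. \<xi> (\<pi> j)) = \<Phi> \<xi>) \<and>
     (\<forall>\<xi>\<in>c00. \<Phi> (\<lambda>j. \<bar>\<xi> j\<bar>) = \<Phi> \<xi>)"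

definition sn_max :: "(nat \<Rightarrow> real) \<Rightarrow> real" where
  "sn_max \<xi> = (\<Sum>j | \<xi> j \<noteq> 0. \<bar>\<xi> j\<bar>)"

definition sn_equivalent ::
  "((nat \<Rightarrow> real) \<Rightarrow> real) \<Rightarrow> ((nat \<Rightarrow> real) \<Rightarrow> real) \<Rightarrow> bool" where
  "sn_equivalent \<Phi> \<Psi> \<longleftrightarrow>
     bdd_above ((\<lambda>\<xi>. \<Phi> \<xi> / \<Psi> \<xi>) ` (c00 - {\<lambda>_. 0})) \<and>
     bdd_above ((\<lambda>\<xi>. \<Psi> \<xi> / \<Phi> \<xi>) ` (c00 - {\<lambda>_. 0}))"

definition sn_norm ::
  "((nat \<Rightarrow> real) \<Rightarrow> real) \<Rightarrow> ('a::chilbert_space \<Rightarrow> 'a) \<Rightarrow> real" where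
  "sn_norm \<Phi> K = lim (\<lambda>n. \<Phi> (\<lambda>j. if j < n then singular_value K j else 0))"

text \<open>The \<open>\<Phi>\<^sup>*\<close>-norm on bounded operators, defined by trace duality and hence
  directly in terms of \<open>\<Phi>\<close>.\<close>

definition sn_dual_norm ::
  "((nat \<Rightarrow> real) \<Rightarrow> real) \<Rightarrow> ('a::chilbert_space \<Rightarrow> 'a) \<Rightarrow> real" where
  "sn_dual_norm \<Phi> T = Sup {cmod (ctrace (T \<circ> K)) | K. trace_class K \<and> sn_norm \<Phi> K \<le> 1}"

definition dual_norming ::
  "((nat \<Rightarrow> real) \<Rightarrow> real) \<Rightarrow> ('a::chilbert_space \<Rightarrow> 'a) \<Rightarrow> bool" where
  "dual_norming \<Phi> T \<longleftrightarrow>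
     (\<exists>K. trace_class K \<and> sn_norm \<Phi> K = 1 \<and> cmod (ctrace (T \<circ> K)) = sn_dual_norm \<Phi> T)"

definition absolutely_dual_norming ::
  "((nat \<Rightarrow> real) \<Rightarrow> real) \<Rightarrow> ('a::chilbert_space \<Rightarrow> 'a) \<Rightarrow> bool" where
  "absolutely_dual_norming \<Phi> T \<longleftrightarrow> bounded_clinear T \<and>
     (\<forall>M. complex_vector.subspace M \<and> closed M \<and> M \<noteq> {0}
        \<longrightarrow> dual_norming \<Phi> (T \<circ> cprojection M))"

end

theory Submission
  imports Defs
begin

text \<open>
  Write \<open>a\<close> for the singular values of \<open>A = T P\<^sub>M\<close>, which is again compact.  By Ky Fan's inequality
  and Abel summation, \<open>\<bar>Tr(AK)\<bar> \<le> \<Sum>\<^sub>j a\<^sub>j s\<^sub>j(K)\<close> for every trace class \<open>K\<close>.  The nonincreasing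
  sequences in the unit ball of \<open>\<Phi>\<close> are bounded in \<open>\<ell>\<^sup>1\<close> because \<open>\<Phi>\<close> is equivalent to the maximal
  norming function, so they form a compact set for coordinatewise convergence, and
  \<open>\<xi> \<mapsto> \<Sum>\<^sub>j a\<^sub>j \<xi>\<^sub>j\<close> is continuous on it because \<open>a\<^sub>j \<longlonglongrightarrow> 0\<close>.  If \<open>\<xi>\<close> is a maximiser, the operator with
  singular values \<open>\<xi>\<close> that sends the left singular vectors of \<open>A\<close> back to the right ones attains
  the dual norm.
\<close>

section \<open>Complex inner products and orthonormal families\<close>

text \<open>Being norming requires an operator of norm exactly 1, while the compact set only
  provides sequences of norm at most 1. If \<open>A\<close> is nonzero, the maximum is positive and
  a maximiser of norm r < 1 could be enlarged by the factor 1/r, so its norm is 1. If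
  \<open>A = 0\<close>, this argument breaks down, but then every operator of norm 1 is extremal; a
  rank one projection serves, and \<open>M\<close> supplies the vector for it.

  A maximiser may also be positive at indices where \<open>a\<close> vanishes, and there
  \<open>A\<close> offers no singular vectors; the space may even be finite-dimensional. Those
  coordinates are cut off. This leaves the pairing unchanged and does not increase the norm, because
  deleting coordinates never increases a symmetric norming function.

  Singular values and the trace are given by definite descriptions, so evaluating them takes
  existence and uniqueness. Both are evaluated through expansions of K x as the sum of s_j <x, e_j>
  f_j, with zero vectors wherever s_j = 0. The dual norm is evaluated by exhibiting a maximum of the
  set whose supremum it is.\<close>

lemma cinner_add_right: "cinner x (y + z) = cinner x y + cinner x (z::'a::complex_inner)"
  by (metis cinner_commute cinner_add_left complex_cnj_add)

lemma cinner_scaleC_right: "cinner x (c *\<^sub>C y) = cnj c * cinner x (y::'a::complex_inner)"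
  by (metis cinner_commute cinner_scaleC_left complex_cnj_mult)

lemma cinner_self: "cinner x x = complex_of_real ((norm (x::'a::complex_inner))\<^sup>2)"
proof -
  have "cinner x x = cnj (cinner x x)" by (rule cinner_commute)
  then have "Im (cinner x x) = 0" by (simp add: complex_eq_iff)
  moreover have "Re (cinner x x) = (norm x)\<^sup>2"
    using cinner_ge_zero[of x] by (simp add: norm_eq_sqrt_cinner)
  ultimately show ?thesis by (simp add: complex_eq_iff)
qed

lemma norm_scaleC: "norm (c *\<^sub>C x) = cmod c * norm (x::'a::complex_inner)"
proof -
  have "complex_of_real ((norm (c *\<^sub>C x))\<^sup>2) = (c * cnj c) * cinner x x"
    unfolding cinner_self[symmetric] by (simp add: cinner_scaleC_left cinner_scaleC_right)
  also have "\<dots> = complex_of_real ((cmod c * norm x)\<^sup>2)"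
    unfolding cinner_self complex_norm_square[symmetric] by (simp add: power_mult_distrib)
  finally have "(norm (c *\<^sub>C x))\<^sup>2 = (cmod c * norm x)\<^sup>2" by (simp only: of_real_eq_iff)
  then show ?thesis by (metis norm_ge_zero power2_eq_imp_eq zero_le_mult_iff)
qed

lemma power2_norm_add:
  "(norm (x + y))\<^sup>2 = (norm x)\<^sup>2 + (norm y)\<^sup>2 + 2 * Re (cinner x (y::'a::complex_inner))"
proof -
  have "Re (cinner y x) = Re (cinner x y)"
    by (metis cinner_commute cnj.simps(1))
  moreover have "(norm z)\<^sup>2 = Re (cinner z z)" for z :: 'a by (simp add: cinner_self)
  ultimately show ?thesis by (simp add: cinner_add_left cinner_add_right)
qed

lemma cinner_Cauchy_Schwarz: "cmod (cinner x y) \<le> norm x * norm (y::'a::complex_inner)"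
proof (cases "y = 0")
  case True
  have "cinner x (0 + 0) = cinner x 0 + cinner x (0::'a)" by (rule cinner_add_right)
  with True show ?thesis by simp
next
  case False
  define c where "c = cinner x y"
  \<comment> \<open>This \<open>d\<close> makes \<open>x + d *\<^sub>C y\<close> the component of
    \<open>x\<close> orthogonal to \<open>y\<close>; its squared norm being nonnegative is the
    claim.\<close>
  define d where "d = - (c / complex_of_real ((norm y)\<^sup>2))"
  have "0 \<le> (norm (x + d *\<^sub>C y))\<^sup>2" by simp
  also have "\<dots> = (norm x)\<^sup>2 + (cmod d * norm y)\<^sup>2 + 2 * Re (cnj d * c)"
    by (simp add: power2_norm_add norm_scaleC cinner_scaleC_right c_def)
  also have "cnj d * c = - complex_of_real ((cmod c)\<^sup>2 / (norm y)\<^sup>2)"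
    by (simp add: d_def complex_norm_square[symmetric] mult.commute[of _ c] flip: of_real_power)
  also have "(cmod d * norm y)\<^sup>2 = (cmod c)\<^sup>2 / (norm y)\<^sup>2"
    using False by (simp add: d_def norm_divide norm_mult norm_power power2_eq_square)
  finally have "(cmod c)\<^sup>2 / (norm y)\<^sup>2 \<le> (norm x)\<^sup>2" by simp
  then have "(cmod c)\<^sup>2 \<le> (norm x * norm y)\<^sup>2"
    using False by (simp add: pos_divide_le_eq power_mult_distrib)
  then show ?thesis unfolding c_def by (rule power2_le_imp_le) simp
qed

interpretation cinner: bounded_bilinear "cinner :: 'a::complex_inner \<Rightarrow> 'a \<Rightarrow> complex"
proof
  fix a a' b b' :: 'a and r :: real
  show "cinner (a + a') b = cinner a b + cinner a' b" by (rule cinner_add_left)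
  show "cinner a (b + b') = cinner a b + cinner a b'" by (rule cinner_add_right)
  show "cinner (r *\<^sub>R a) b = r *\<^sub>R cinner a b"
    by (simp add: scaleR_scaleC cinner_scaleC_left scaleR_conv_of_real)
  show "cinner a (r *\<^sub>R b) = r *\<^sub>R cinner a b"
    by (simp add: scaleR_scaleC cinner_scaleC_right scaleR_conv_of_real)
  show "\<exists>K. \<forall>a b :: 'a. norm (cinner a b) \<le> norm a * norm b * K"
    by (rule exI[of _ 1]) (simp add: cinner_Cauchy_Schwarz)
qed

interpretation scaleC: bounded_bilinear "scaleC :: complex \<Rightarrow> 'a::complex_inner \<Rightarrow> 'a"
proof
  fix a a' :: complex and b b' :: 'a and r :: real
  show "(a + a') *\<^sub>C b = a *\<^sub>C b + a' *\<^sub>C b" by (rule scaleC_add_left)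
  show "a *\<^sub>C (b + b') = a *\<^sub>C b + a *\<^sub>C b'" by (rule scaleC_add_right)
  show "(r *\<^sub>R a) *\<^sub>C b = r *\<^sub>R (a *\<^sub>C b)"
    by (simp add: scaleR_scaleC scaleC_scaleC scaleR_conv_of_real)
  show "a *\<^sub>C (r *\<^sub>R b) = r *\<^sub>R (a *\<^sub>C b)"
    by (simp add: scaleR_scaleC scaleC_scaleC mult.commute)
  show "\<exists>K. \<forall>a (b :: 'a). norm (a *\<^sub>C b) \<le> norm a * norm b * K"
    by (rule exI[of _ 1]) (simp add: norm_scaleC)
qed

lemmas cinner_simps = cinner.add_left cinner.add_right cinner.diff_left cinner.diff_right
  cinner.minus_left cinner.minus_right cinner.scaleR_left cinner.scaleR_right
  cinner_scaleC_left cinner_scaleC_right cinner.sum_left cinner.sum_right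

lemma cinner_eq_0_commute: "cinner x y = 0 \<longleftrightarrow> cinner y x = (0::complex)"
  for x y :: "'a::complex_inner"
  by (metis cinner_commute complex_cnj_zero)

lemma cmod_cinner_commute: "cmod (cinner x y) = cmod (cinner y (x::'a::complex_inner))"
  by (metis cinner_commute complex_mod_cnj)

lemma cinner_ext:
  fixes x y :: "'a::complex_inner"
  assumes "\<And>z. cinner z x = cinner z y"
  shows "x = y"
proof -
  have "cinner (x - y) (x - y) = 0" using assms by (simp add: cinner_simps)
  then show ?thesis by (simp add: cinner_eq_zero_iff)
qed

lemma parallelogram:
  fixes x y :: "'a::complex_inner"
  shows "(norm (x - y))\<^sup>2 = 2 * (norm x)\<^sup>2 + 2 * (norm y)\<^sup>2 - (norm (x + y))\<^sup>2"
  using power2_norm_add[of x y] power2_norm_add[of x "- y"] by (simp add: cinner_simps)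

lemma power2_norm_diff_orthogonal:
  fixes x y :: "'a::complex_inner"
  assumes "cinner (x - y) y = 0"
  shows "(norm x)\<^sup>2 = (norm (x - y))\<^sup>2 + (norm y)\<^sup>2"
  using power2_norm_add[of "x - y" y] assms by simp

lemma bounded_clinear_imp_bounded_linear: "bounded_clinear K \<Longrightarrow> bounded_linear K"
  by (simp add: bounded_clinear_def)

lemma bounded_clinear_scaleC: "bounded_clinear K \<Longrightarrow> K (c *\<^sub>C x) = c *\<^sub>C K x"
  by (simp add: bounded_clinear_def)

lemma bounded_clinear_diff: "bounded_clinear K \<Longrightarrow> K (x - y) = K x - K y"
  by (simp add: bounded_clinear_def bounded_linear.linear linear_diff)

lemma bounded_clinear_add: "bounded_clinear K \<Longrightarrow> K (x + y) = K x + K y"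
  by (simp add: bounded_clinear_def bounded_linear.linear linear_add)

text \<open>Zero vectors are allowed, so that finite and infinite orthonormal systems share one index type.\<close>

definition orthonormal_family :: "('i \<Rightarrow> 'a::complex_inner) \<Rightarrow> bool" where
  "orthonormal_family e \<longleftrightarrow> (\<forall>i j. cinner (e i) (e j) = (if i = j \<and> e i \<noteq> 0 then 1 else 0))"

lemma orthonormal_familyD:
  "orthonormal_family e \<Longrightarrow> cinner (e i) (e j) = (if i = j \<and> e i \<noteq> 0 then 1 else 0)"
  by (simp add: orthonormal_family_def)

lemma norm_orthonormal_family:
  assumes "orthonormal_family e"
  shows "norm (e i) = (if e i = 0 then 0 else 1)"
proof -
  have "complex_of_real ((norm (e i))\<^sup>2) = of_real (if e i = 0 then 0 else 1)"
    using orthonormal_familyD[OF assms, of i i] cinner_self[of "e i"] by simp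
  then have "(norm (e i))\<^sup>2 = (if e i = 0 then 0 else 1)" by (simp only: of_real_eq_iff)
  then show ?thesis by (auto simp: power2_eq_1_iff)
      (metis norm_ge_zero neg_0_le_iff_le not_one_le_zero)
qed

lemma norm_orthonormal_family_le:
  assumes "orthonormal_family e"
  shows "norm (e i) \<le> 1"
  using norm_orthonormal_family[OF assms] by simp

text \<open>An inequality, because the coefficient of a zero vector counts on the right but not on
  the left.\<close>

lemma Pythagoras_sum:
  fixes e :: "'i \<Rightarrow> 'a::complex_inner"
  assumes e: "orthonormal_family e" and "finite F"
  shows "(norm (\<Sum>i\<in>F. c i *\<^sub>C e i))\<^sup>2 \<le> (\<Sum>i\<in>F. (cmod (c i))\<^sup>2)"
  using \<open>finite F\<close>
proof induction
  case (insert a F)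
  have "cinner (c a *\<^sub>C e a) (\<Sum>i\<in>F. c i *\<^sub>C e i) = 0"
    using insert.hyps orthonormal_familyD[OF e] by (auto simp: cinner_simps intro!: sum.neutral)
  moreover have "(norm (c a *\<^sub>C e a))\<^sup>2 \<le> (cmod (c a))\<^sup>2"
    using norm_orthonormal_family[OF e, of a] by (simp add: norm_scaleC power_mult_distrib)
  ultimately show ?case using insert by (simp add: power2_norm_add add_mono del: power_mono_iff power2_le_iff_abs_le abs_le_square_iff)
qed simp

text \<open>The remainder after subtracting the projections onto \<open>F\<close> still has the same
  coefficient at a new index, and subtracting that component removes an orthogonal piece. A zero
  vector contributes nothing on either side, so the identity stays exact.\<close>

lemma Bessel:
  fixes e :: "'i \<Rightarrow> 'a::complex_inner"
  assumes e: "orthonormal_family e" and "finite F"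
  shows "(norm (x - (\<Sum>i\<in>F. cinner x (e i) *\<^sub>C e i)))\<^sup>2 = (norm x)\<^sup>2 - (\<Sum>i\<in>F. (cmod (cinner x (e i)))\<^sup>2)"
  using \<open>finite F\<close>
proof induction
  case (insert a F)
  define y where "y = x - (\<Sum>i\<in>F. cinner x (e i) *\<^sub>C e i)"
  define c where "c = cinner x (e a)"
  have ya: "cinner y (e a) = c"
    using insert.hyps orthonormal_familyD[OF e]
    by (auto simp: y_def c_def cinner_simps intro!: sum.neutral)
  have y: "x - (\<Sum>i\<in>insert a F. cinner x (e i) *\<^sub>C e i) = y - c *\<^sub>C e a"
    using insert.hyps by (simp add: y_def c_def)
  have "c = 0" if "e a = 0" using that by (simp add: c_def cinner.zero_right)
  then have "cinner (y - c *\<^sub>C e a) (c *\<^sub>C e a) = 0" and n: "norm (c *\<^sub>C e a) = cmod c"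
    using norm_orthonormal_family[OF e, of a] orthonormal_familyD[OF e, of a a] ya
    by (auto simp: cinner_simps norm_scaleC)
  from power2_norm_diff_orthogonal[OF this(1)] show ?case
    unfolding y n using insert by (simp add: y_def c_def)
qed simp

lemma Bessel_inequality:
  fixes e :: "'i \<Rightarrow> 'a::complex_inner"
  assumes e: "orthonormal_family e"
  shows "(\<Sum>i\<in>F. (cmod (cinner x (e i)))\<^sup>2) \<le> (norm x)\<^sup>2"
proof (cases "finite F")
  case True
  have "0 \<le> (norm (x - (\<Sum>i\<in>F. cinner x (e i) *\<^sub>C e i)))\<^sup>2" by simp
  then show ?thesis unfolding Bessel[OF e True] by simp
qed simp

text \<open>Cauchy-Schwarz for two coefficient sequences. It makes the weights in Ky Fan's
  inequality doubly substochastic and dominates the partial sums of the trace.\<close>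

lemma Bessel_bilinear:
  fixes e f :: "'i \<Rightarrow> 'a::complex_inner"
  assumes "orthonormal_family e" "orthonormal_family f"
  shows "(\<Sum>i\<in>F. cmod (cinner x (e i)) * cmod (cinner y (f i))) \<le> norm x * norm y"
proof -
  have "(\<Sum>i\<in>F. \<bar>cmod (cinner x (e i)) * cmod (cinner y (f i))\<bar>)
      \<le> L2_set (\<lambda>i. cmod (cinner x (e i))) F * L2_set (\<lambda>i. cmod (cinner y (f i))) F"
    using L2_set_mult_ineq[of "\<lambda>i. cmod (cinner x (e i))" "\<lambda>i. cmod (cinner y (f i))" F]
    by (simp add: abs_mult)
  also have "\<dots> \<le> norm x * norm y"
    unfolding L2_set_def
    by (intro mult_mono real_le_lsqrt Bessel_inequality assms) (auto intro: sum_nonneg)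
  finally show ?thesis by simp
qed

text \<open>The projection fixes every combination y of the family, so x - P x = (x - y) - P (x -
  y), and by Bessel's identity this is no longer than x - y.\<close>

lemma norm_minus_projection_le:
  fixes e :: "'i \<Rightarrow> 'a::complex_inner"
  assumes e: "orthonormal_family e" and "finite F"
  shows "norm (x - (\<Sum>i\<in>F. cinner x (e i) *\<^sub>C e i)) \<le> norm (x - (\<Sum>i\<in>F. c i *\<^sub>C e i))"
proof -
  define y where "y = (\<Sum>i\<in>F. c i *\<^sub>C e i)"
  define P where "P = (\<lambda>x. \<Sum>i\<in>F. cinner x (e i) *\<^sub>C e i)"
  have "P y = y"
    unfolding P_def y_def
  proof (rule sum.cong[OF refl])
    fix i assume "i \<in> F"
    have "cinner (\<Sum>j\<in>F. c j *\<^sub>C e j) (e i) = (\<Sum>j\<in>F. if j = i then c i * (if e i \<noteq> 0 then 1 else 0) else 0)"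
      using orthonormal_familyD[OF e] by (auto simp: cinner_simps intro!: sum.cong)
    then show "cinner (\<Sum>j\<in>F. c j *\<^sub>C e j) (e i) *\<^sub>C e i = c i *\<^sub>C e i"
      using \<open>i \<in> F\<close> \<open>finite F\<close> by (cases "e i = 0") (simp_all add: sum.delta)
  qed
  moreover have "P (x - y) = P x - P y"
    by (simp add: P_def cinner_simps scaleC.diff_left sum_subtractf)
  ultimately have eq: "x - P x = (x - y) - P (x - y)" by simp
  have "(norm ((x - y) - P (x - y)))\<^sup>2 \<le> (norm (x - y))\<^sup>2"
    unfolding P_def Bessel[OF e \<open>finite F\<close>] by (simp add: sum_nonneg)
  then have "norm (x - P x) \<le> norm (x - y)"
    unfolding eq by (rule power2_le_imp_le) simp
  then show ?thesis by (simp only: P_def y_def)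
qed

section \<open>Projections, orthonormal bases and the trace\<close>

text \<open>For \<open>c\<close> a small positive multiple of \<open>a\<close> the left side is
  linear in the multiple and the right side quadratic. This is the first-order condition at an
  extremum, applied both to nearest points and to norm maximisers.\<close>

lemma eq_0_if_quadratic_bound:
  fixes a :: complex
  assumes "\<And>c. 2 * Re (cnj c * a) \<le> (cmod c)\<^sup>2 * D"
  shows "a = 0"
proof (rule ccontr)
  assume "a \<noteq> 0"
  define t where "t = 1 / (\<bar>D\<bar> + 1)"
  have t: "t > 0" "t * D < 2"
    unfolding t_def by (auto simp: field_simps)
  have "Re (cnj (complex_of_real t * a) * a) = t * (cmod a)\<^sup>2"
    unfolding cmod_power2 by (simp add: power2_eq_square algebra_simps)
  then have "2 * t * (cmod a)\<^sup>2 \<le> t * (cmod a)\<^sup>2 * (t * D)"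
    using assms[of "complex_of_real t * a"] t
    by (simp add: norm_mult power_mult_distrib power2_eq_square mult_ac)
  moreover have "t * (cmod a)\<^sup>2 * (t * D) < t * (cmod a)\<^sup>2 * 2"
    using t \<open>a \<noteq> 0\<close> by (intro mult_strict_left_mono) auto
  ultimately show False by linarith
qed

text \<open>By the parallelogram law; minimising and maximising sequences below are Cauchy for this reason.\<close>

lemma Cauchy_if_norm_sum_large:
  fixes u :: "nat \<Rightarrow> 'a::complex_inner"
  assumes lim: "(\<lambda>n. norm (u n)) \<longlonglongrightarrow> d"
    and large: "\<And>\<epsilon>. \<epsilon> > 0 \<Longrightarrow> \<exists>N. \<forall>m\<ge>N. \<forall>n\<ge>N. 2 * d - \<epsilon> \<le> norm (u m + u n)"
  shows "Cauchy u"
proof (rule metric_CauchyI)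
  fix \<epsilon> :: real assume "\<epsilon> > 0"
  have "d \<ge> 0" using lim by (rule LIMSEQ_le_const) simp
  \<comment> \<open>The parallelogram law will bound the squared distance by \<epsilon> squared over
    2, coming from the two norms, plus \<open>4 * d * \<eta>\<close>; \<eta> is chosen to make the
    latter at most the other half. The added 1 covers \<open>d = 0\<close>.\<close>
  define \<eta> where "\<eta> = \<epsilon>\<^sup>2 / (8 * (d + 1))"
  have "\<eta> > 0" using \<open>\<epsilon> > 0\<close> \<open>d \<ge> 0\<close> by (simp add: \<eta>_def)
  have \<eta>: "4 * d * \<eta> \<le> \<epsilon>\<^sup>2 / 2"
    using \<open>d \<ge> 0\<close> by (simp add: \<eta>_def field_simps)
  obtain N where N: "\<And>m n. m \<ge> N \<Longrightarrow> n \<ge> N \<Longrightarrow> 2 * d - \<eta> \<le> norm (u m + u n)"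
    using large[OF \<open>\<eta> > 0\<close>] by auto
  have "(\<lambda>n. (norm (u n))\<^sup>2) \<longlonglongrightarrow> d\<^sup>2" by (intro tendsto_intros lim)
  moreover have "d\<^sup>2 < d\<^sup>2 + \<epsilon>\<^sup>2 / 8" using \<open>\<epsilon> > 0\<close> by simp
  ultimately have "eventually (\<lambda>n. (norm (u n))\<^sup>2 < d\<^sup>2 + \<epsilon>\<^sup>2 / 8) sequentially"
    by (rule order_tendstoD)
  then obtain N' where N': "\<And>n. n \<ge> N' \<Longrightarrow> (norm (u n))\<^sup>2 < d\<^sup>2 + \<epsilon>\<^sup>2 / 8"
    by (auto simp: eventually_sequentially)
  have "dist (u m) (u n) < \<epsilon>" if "m \<ge> max N N'" "n \<ge> max N N'" for m n
  proof -
    have "4 * d\<^sup>2 - 4 * d * \<eta> \<le> (norm (u m + u n))\<^sup>2"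
    proof (cases "2 * d \<ge> \<eta>")
      case True
      then have "(2 * d - \<eta>)\<^sup>2 \<le> (norm (u m + u n))\<^sup>2"
        using N[of m n] that by (intro power_mono) auto
      moreover have "(2 * d - \<eta>)\<^sup>2 = 4 * d\<^sup>2 - 4 * d * \<eta> + \<eta>\<^sup>2"
        by (simp add: power2_eq_square algebra_simps)
      ultimately show ?thesis using zero_le_power2[of \<eta>] by linarith
    next
      case False
      then have "d * d \<le> d * \<eta>" using \<open>d \<ge> 0\<close> by (intro mult_left_mono) auto
      then show ?thesis using zero_le_power2[of "norm (u m + u n)"]
        unfolding power2_eq_square[of d] by linarith
    qed
    then have "(norm (u m - u n))\<^sup>2 < \<epsilon>\<^sup>2"
      using N'[of m] N'[of n] that \<eta> unfolding parallelogram by simp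
    then show ?thesis using \<open>\<epsilon> > 0\<close> by (simp add: dist_norm power2_less_imp_less)
  qed
  then show "\<exists>M. \<forall>m\<ge>M. \<forall>n\<ge>M. dist (u m) (u n) < \<epsilon>" by blast
qed

text \<open>Midpoints of a minimising sequence stay in \<open>M\<close>, so the sum of two residuals
  has norm at least 2d and the residuals form a Cauchy sequence. Their limit has minimal norm, and
  moving within \<open>M\<close> cannot shorten it, which forces orthogonality.\<close>

lemma orthogonal_projection_exists:
  fixes M :: "'a::chilbert_space set"
  assumes sub: "complex_vector.subspace M" and "closed M"
  shows "\<exists>y\<in>M. \<forall>z\<in>M. cinner (x - y) z = 0"
proof -
  define d where "d = infdist x M"
  have "M \<noteq> {}" using sub complex_vector.subspace_0 by auto
  have d_le: "d \<le> norm (x - y)" if "y \<in> M" for y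
    using infdist_le[OF that, of x] by (simp add: d_def dist_norm)
  have "\<exists>y\<in>M. norm (x - y) < d + inverse (real (Suc n))" for n
  proof (rule ccontr)
    assume "\<not> ?thesis"
    then have "d + inverse (real (Suc n)) \<le> infdist x M"
      using \<open>M \<noteq> {}\<close> unfolding infdist_notempty[OF \<open>M \<noteq> {}\<close>]
      by (intro cINF_greatest) (auto simp: dist_norm not_less)
    then show False by (simp add: d_def)
  qed
  then obtain y where y: "\<And>n. y n \<in> M" "\<And>n. norm (x - y n) < d + inverse (real (Suc n))"
    by metis
  have lim: "(\<lambda>n. norm (x - y n)) \<longlonglongrightarrow> d"
  proof (rule tendsto_sandwich[where f = "\<lambda>_. d"])
    show "(\<lambda>n. d + inverse (real (Suc n))) \<longlonglongrightarrow> d"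
      by (rule LIMSEQ_inverse_real_of_nat_add)
  qed (use d_le[OF y(1)] less_imp_le[OF y(2)] in \<open>simp_all del: of_nat_Suc\<close>)
  have "Cauchy (\<lambda>n. x - y n)"
  proof (rule Cauchy_if_norm_sum_large[OF lim])
    fix \<epsilon> :: real assume "\<epsilon> > 0"
    have "2 * d - \<epsilon> \<le> norm ((x - y m) + (x - y n))" for m n
    proof -
      have "(1/2) *\<^sub>R (y m + y n) \<in> M"
        unfolding scaleR_scaleC using y(1) sub
        by (intro complex_vector.subspace_scale complex_vector.subspace_add) auto
      from d_le[OF this] have "2 * d \<le> norm (2 *\<^sub>R (x - (1/2) *\<^sub>R (y m + y n)))" by simp
      also have "2 *\<^sub>R (x - (1/2) *\<^sub>R (y m + y n)) = (x - y m) + (x - y n)"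
        by (simp add: algebra_simps scaleR_2)
      finally show ?thesis using \<open>\<epsilon> > 0\<close> by linarith
    qed
    then show "\<exists>N. \<forall>m\<ge>N. \<forall>n\<ge>N. 2 * d - \<epsilon> \<le> norm ((x - y m) + (x - y n))" by blast
  qed
  then obtain w where w: "(\<lambda>n. x - y n) \<longlonglongrightarrow> w" using Cauchy_convergent_iff convergent_def by blast
  have "(\<lambda>n. x - (x - y n)) \<longlonglongrightarrow> x - w" by (intro tendsto_intros w)
  then have "x - w \<in> M" using y(1) closed_sequentially[OF \<open>closed M\<close>] by auto
  have "norm w = d" using tendsto_norm[OF w] lim by (rule LIMSEQ_unique)
  have "cinner w z = 0" if "z \<in> M" for z
  proof (rule eq_0_if_quadratic_bound)
    fix c
    have "x - w + c *\<^sub>C z \<in> M"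
      using sub \<open>x - w \<in> M\<close> that
      by (intro complex_vector.subspace_scale complex_vector.subspace_add) auto
    from d_le[OF this] have "norm w \<le> norm (w + (- c) *\<^sub>C z)"
      by (simp add: \<open>norm w = d\<close> scaleC.minus_left algebra_simps)
    then have "(norm w)\<^sup>2 \<le> (norm (w + (- c) *\<^sub>C z))\<^sup>2" by (intro power_mono) auto
    then show "2 * Re (cnj c * cinner w z) \<le> (cmod c)\<^sup>2 * (norm z)\<^sup>2"
      unfolding power2_norm_add by (simp add: norm_scaleC cinner_scaleC_right cinner.minus_right power_mult_distrib scaleC.minus_left)
  qed
  then show ?thesis using \<open>x - w \<in> M\<close> by (intro bexI[of _ "x - w"]) auto
qed

lemma cprojection_eqI:
  assumes "complex_vector.subspace M" "y \<in> M" "\<And>z. z \<in> M \<Longrightarrow> cinner (x - y) z = 0"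
  shows "cprojection M x = y"
  unfolding cprojection_def
proof (rule the_equality)
  fix y' assume y': "y' \<in> M \<and> (\<forall>z\<in>M. cinner (x - y') z = 0)"
  have "y' - y \<in> M" using assms y' complex_vector.subspace_diff by blast
  then have "cinner (x - y) (y' - y) - cinner (x - y') (y' - y) = 0"
    using assms y' by simp
  then have "cinner (y' - y) (y' - y) = 0"
    unfolding cinner.diff_left[symmetric] by simp
  then show "y' = y" by (simp add: cinner_eq_zero_iff)
qed (use assms in auto)

lemma cprojection:
  assumes "complex_vector.subspace M" "closed M"
  shows "cprojection M x \<in> M" "z \<in> M \<Longrightarrow> cinner (x - cprojection M x) z = 0"
  using orthogonal_projection_exists[OF assms, of x] cprojection_eqI[OF assms(1)] by auto

lemma norm_cprojection_le:
  assumes "complex_vector.subspace M" "closed M"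
  shows "norm (cprojection M x) \<le> norm x"
proof -
  have "(norm x)\<^sup>2 = (norm (x - cprojection M x))\<^sup>2 + (norm (cprojection M x))\<^sup>2"
    using cprojection[OF assms] by (intro power2_norm_diff_orthogonal) auto
  then have "(norm (cprojection M x))\<^sup>2 \<le> (norm x)\<^sup>2" by simp
  then show ?thesis by (rule power2_le_imp_le) simp
qed

lemma bounded_clinear_cprojection:
  assumes M: "complex_vector.subspace M" "closed M"
  shows "bounded_clinear (cprojection M)"
proof -
  note P = cprojection[OF M]
  have add: "cprojection M (x + y) = cprojection M x + cprojection M y" for x y
  proof (rule cprojection_eqI[OF M(1)])
    show "cprojection M x + cprojection M y \<in> M" using P M complex_vector.subspace_add by blast
    fix z assume "z \<in> M"
    then show "cinner (x + y - (cprojection M x + cprojection M y)) z = 0"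
      using P(2)[of z x] P(2)[of z y] by (simp add: cinner_simps)
  qed
  have scale: "cprojection M (c *\<^sub>C x) = c *\<^sub>C cprojection M x" for c x
  proof (rule cprojection_eqI[OF M(1)])
    show "c *\<^sub>C cprojection M x \<in> M" using P M complex_vector.subspace_scale by blast
    fix z assume "z \<in> M"
    then show "cinner (c *\<^sub>C x - c *\<^sub>C cprojection M x) z = 0"
      using P(2)[of z x] by (simp flip: scaleC.diff_right add: cinner_scaleC_left)
  qed
  have "bounded_linear (cprojection M)"
    by (rule bounded_linear_intro[where K = 1])
      (simp_all add: add scale scaleR_scaleC norm_cprojection_le[OF M])
  with scale show ?thesis by (simp add: bounded_clinear_def)
qed

text \<open>A projection is a contraction, so the new image of the unit ball lies inside the old
  one.\<close>

lemma compact_operator_comp_cprojection: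
  assumes T: "compact_operator T" and M: "complex_vector.subspace M" "closed M"
  shows "compact_operator (T \<circ> cprojection M)"
proof -
  have "bounded_clinear (T \<circ> cprojection M)"
    using T bounded_clinear_cprojection[OF M] bounded_linear_compose
    by (auto simp: compact_operator_def bounded_clinear_def comp_def)
  moreover have "(T \<circ> cprojection M) ` cball 0 1 \<subseteq> T ` cball 0 1"
    using norm_cprojection_le[OF M] order_trans by fastforce
  then have "compact (closure ((T \<circ> cprojection M) ` cball 0 1))"
    using T closed_Int_compact[OF closed_closure, of "closure (T ` cball 0 1)"]
      Int_absorb2[OF closure_mono] unfolding compact_operator_def by metis
  ultimately show ?thesis by (simp add: compact_operator_def)
qed

section \<open>Orthonormal bases and expansions\<close>

lemma subspace_closure:
  fixes S :: "'a::complex_inner set"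
  assumes "complex_vector.subspace S"
  shows "complex_vector.subspace (closure S)"
proof (rule complex_vector.subspaceI)
  show "0 \<in> closure S" using assms complex_vector.subspace_0 closure_subset by blast
  fix x y :: 'a and c assume "x \<in> closure S"
  then obtain u where u: "\<And>n. u n \<in> S" "u \<longlonglongrightarrow> x" by (auto simp: closure_sequential)
  show "c *\<^sub>C x \<in> closure S"
    unfolding closure_sequential
    using u assms complex_vector.subspace_scale
    by (intro exI[of _ "\<lambda>n. c *\<^sub>C u n"]) (auto intro!: scaleC.tendsto)
  assume "y \<in> closure S"
  then obtain v where v: "\<And>n. v n \<in> S" "v \<longlonglongrightarrow> y" by (auto simp: closure_sequential)
  show "x + y \<in> closure S"
    unfolding closure_sequential
    using u v complex_vector.subspace_add[OF assms]
    by (intro exI[of _ "\<lambda>n. u n + v n"]) (auto intro!: tendsto_add)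
qed

text \<open>Uniqueness in \<open>ctrace\<close> rests on this: if there were no basis, every number
  would satisfy the description. A vector outside the closed span of a maximal orthonormal set has a
  residual orthogonal to the set, and its normalisation would extend the set.\<close>

lemma orthonormal_basis_exists: "\<exists>B :: 'a::chilbert_space set. orthonormal_basis B"
proof -
  define on :: "'a set \<Rightarrow> bool"
    where "on B \<longleftrightarrow> (\<forall>x\<in>B. \<forall>y\<in>B. cinner x y = (if x = y then 1 else 0))" for B
  have "\<exists>B\<in>Collect on. \<forall>X\<in>Collect on. B \<subseteq> X \<longrightarrow> X = B"
  proof (rule subset_Zorn')
    fix C assume C: "subset.chain (Collect on) C"
    have "cinner x y = (if x = y then 1 else 0)" if xy: "x \<in> \<Union>C" "y \<in> \<Union>C" for x y
    proof -
      obtain X Y where "x \<in> X" "X \<in> C" "y \<in> Y" "Y \<in> C" using xy by blast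
      moreover from this have "X \<subseteq> Y \<or> Y \<subseteq> X" "on X" "on Y"
        using C by (auto simp: subset_chain_def)
      ultimately show ?thesis unfolding on_def by blast
    qed
    then show "\<Union>C \<in> Collect on" by (simp add: on_def)
  qed
  then obtain B where B: "on B" and max: "\<And>X. on X \<Longrightarrow> B \<subseteq> X \<Longrightarrow> X = B" by auto
  let ?M = "closure (complex_vector.span B)"
  have M: "complex_vector.subspace ?M" "closed ?M"
    by (simp_all add: subspace_closure complex_vector.subspace_span)
  have BM: "B \<subseteq> ?M" using complex_vector.span_superset closure_subset by blast
  have "x \<in> ?M" for x
  proof (rule ccontr)
    assume "x \<notin> ?M"
    obtain y where y: "y \<in> ?M" "\<And>z. z \<in> ?M \<Longrightarrow> cinner (x - y) z = 0"
      using orthogonal_projection_exists[OF M, of x] by auto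
    define u where "u = (1 / complex_of_real (norm (x - y))) *\<^sub>C (x - y)"
    have "x \<noteq> y" using y(1) \<open>x \<notin> ?M\<close> by blast
    then have uu: "cinner u u = 1" by (simp add: u_def cinner_self norm_scaleC norm_divide)
    have uz: "cinner u z = 0" if "z \<in> B" for z
      using y(2) that BM by (auto simp: u_def cinner_scaleC_left)
    moreover have "cinner z u = 0" if "z \<in> B" for z
      using uz[OF that] cinner_eq_0_commute by blast
    moreover have "u \<notin> B" using uz uu by fastforce
    ultimately have "on (insert u B)"
      using B uu unfolding on_def by fastforce
    with max \<open>u \<notin> B\<close> show False by blast
  qed
  then have "orthonormal_basis B" using B unfolding orthonormal_basis_def on_def by auto
  then show ?thesis ..
qed

text \<open>Turns the set into a family indexed by the whole space, to which the Bessel estimates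
  apply.\<close>

lemma orthonormal_family_of_basis:
  assumes "orthonormal_basis B"
  shows "orthonormal_family (\<lambda>b. if b \<in> B then b else 0)"
proof -
  have B: "\<And>x y. x \<in> B \<Longrightarrow> y \<in> B \<Longrightarrow> cinner x y = (if x = y then 1 else 0)"
    using assms by (simp add: orthonormal_basis_def)
  from B[of 0 0] have "0 \<notin> B" by (auto simp: cinner.zero_left)
  with B show ?thesis
    unfolding orthonormal_family_def by (auto simp: cinner.zero_left cinner.zero_right)
qed

text \<open>Density gives one finite combination within \<epsilon>, and the projection onto any
  larger finite part of the basis approximates at least as well.\<close>

lemma orthonormal_basis_expansion:
  assumes B: "orthonormal_basis B"
  shows "((\<lambda>b. cinner x b *\<^sub>C b) has_sum x) B"
  unfolding has_sum_def
proof (rule tendstoI)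
  fix \<epsilon> :: real assume "\<epsilon> > 0"
  define e where "e = (\<lambda>b. if b \<in> B then b else 0)"
  have e: "orthonormal_family e" unfolding e_def by (rule orthonormal_family_of_basis[OF B])
  have "x \<in> closure (complex_vector.span B)" using B by (simp add: orthonormal_basis_def)
  then obtain y where y: "y \<in> complex_vector.span B" "dist y x < \<epsilon>"
    using \<open>\<epsilon> > 0\<close> by (meson closure_approachable)
  obtain F0 r where F0: "finite F0" "F0 \<subseteq> B" and y_eq: "y = (\<Sum>b\<in>F0. r b *\<^sub>C b)"
    using y(1) unfolding complex_vector.span_explicit by auto
  have "dist (\<Sum>b\<in>F. cinner x b *\<^sub>C b) x < \<epsilon>" if F: "finite F" "F0 \<subseteq> F" "F \<subseteq> B" for F
  proof -
    have "y = (\<Sum>b\<in>F. (if b \<in> F0 then r b else 0) *\<^sub>C e b)"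
      unfolding y_eq using F
      by (intro sum.mono_neutral_cong_left) (auto simp: e_def scaleC.zero_left)
    then have "norm (x - (\<Sum>b\<in>F. cinner x (e b) *\<^sub>C e b)) \<le> norm (x - y)"
      using norm_minus_projection_le[OF e F(1)] by simp
    also have "(\<Sum>b\<in>F. cinner x (e b) *\<^sub>C e b) = (\<Sum>b\<in>F. cinner x b *\<^sub>C b)"
      using F by (intro sum.cong) (auto simp: e_def)
    finally show ?thesis using y(2) by (simp add: dist_norm norm_minus_commute)
  qed
  then show "\<forall>\<^sub>F F in finite_subsets_at_top B. dist (\<Sum>b\<in>F. cinner x b *\<^sub>C b) x < \<epsilon>"
    unfolding eventually_finite_subsets_at_top using F0 by auto
qed

lemma Parseval:
  assumes B: "orthonormal_basis B"
  shows "((\<lambda>b. cinner x b * cinner b y) has_sum cinner x y) B"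
  using has_sum_bounded_linear[OF cinner.bounded_linear_left[of y] orthonormal_basis_expansion[OF B, of x]]
  by (simp add: comp_def cinner_scaleC_left)

text \<open>Two limits are exchanged, over finite parts of the basis and over \<open>j\<close>. For
  fixed \<open>j\<close> Parseval's identity gives the limit, and the bilinear Bessel estimate
  dominates all partial sums by \<open>s j * C\<close>, so Tannery's theorem applies. The
  \<open>g j\<close> are merely bounded because they will be the images of singular vectors under
  another operator.\<close>

lemma has_sum_diagonal:
  fixes s :: "nat \<Rightarrow> real" and e g :: "nat \<Rightarrow> 'a::chilbert_space"
  assumes B: "orthonormal_basis B"
    and s: "summable s" "\<And>j. 0 \<le> s j"
    and e: "\<And>j. norm (e j) \<le> 1" and g: "\<And>j. norm (g j) \<le> C"
    and L: "\<And>x. (\<lambda>j. s j *\<^sub>R (cinner x (e j) *\<^sub>C g j)) sums L x"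
  shows "((\<lambda>b. cinner (L b) b) has_sum (\<Sum>j. s j *\<^sub>R cinner (g j) (e j))) B"
proof -
  define h where "h = (\<lambda>b. if b \<in> B then b else 0)"
  have h: "orthonormal_family h" unfolding h_def by (rule orthonormal_family_of_basis[OF B])
  define a where "a = (\<lambda>j F. s j *\<^sub>R (\<Sum>b\<in>F. cinner (g j) (h b) * cinner (h b) (e j)))"
  have Cpos: "0 \<le> C" using g[of 0] norm_ge_zero order_trans by blast
  have a_le: "cmod (a j F) \<le> s j * C" for j F
  proof -
    have "cmod (\<Sum>b\<in>F. cinner (g j) (h b) * cinner (h b) (e j))
       \<le> (\<Sum>b\<in>F. cmod (cinner (g j) (h b)) * cmod (cinner (e j) (h b)))"
      by (rule sum_norm_le) (simp add: norm_mult cmod_cinner_commute[of _ "e j"])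
    also have "\<dots> \<le> norm (g j) * norm (e j)" by (rule Bessel_bilinear[OF h h])
    also have "\<dots> \<le> C * 1" using e g Cpos by (intro mult_mono) auto
    finally show ?thesis using s(2)[of j] by (simp add: a_def mult_left_mono)
  qed
  have lim: "((\<lambda>F. a j F) \<longlongrightarrow> s j *\<^sub>R cinner (g j) (e j)) (finite_subsets_at_top B)" for j
  proof -
    have "((\<lambda>b. cinner (g j) (h b) * cinner (h b) (e j)) has_sum cinner (g j) (e j)) B"
      using Parseval[OF B, of "g j" "e j"] by (rule has_sum_cong[THEN iffD1, rotated]) (simp add: h_def)
    then show ?thesis unfolding has_sum_def a_def by (intro tendsto_scaleR tendsto_const)
  qed
  have "summable (\<lambda>j. s j * C)" using s(1) by (rule summable_mult2)
  have "((\<lambda>F. \<Sum>j. a j F) \<longlongrightarrow> (\<Sum>j. s j *\<^sub>R cinner (g j) (e j))) (finite_subsets_at_top B)"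
    using tannerys_theorem[OF lim _ \<open>summable (\<lambda>j. s j * C)\<close>] a_le
    by (simp add: always_eventually)
  moreover have "(\<Sum>j. a j F) = (\<Sum>b\<in>F. cinner (L (h b)) (h b))" for F
  proof (rule sums_unique[symmetric])
    have "(\<lambda>j. \<Sum>b\<in>F. cinner (s j *\<^sub>R (cinner (h b) (e j) *\<^sub>C g j)) (h b)) sums (\<Sum>b\<in>F. cinner (L (h b)) (h b))"
      by (intro sums_sum bounded_linear.sums[OF cinner.bounded_linear_left L])
    then show "(\<lambda>j. a j F) sums (\<Sum>b\<in>F. cinner (L (h b)) (h b))"
      by (simp add: a_def cinner_simps scaleR_sum_right mult.commute)
  qed
  ultimately have "((\<lambda>b. cinner (L (h b)) (h b)) has_sum (\<Sum>j. s j *\<^sub>R cinner (g j) (e j))) B"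
    by (simp add: has_sum_def)
  then show ?thesis by (rule has_sum_cong[THEN iffD1, rotated]) (simp add: h_def)
qed

lemma ctrace_diagonal:
  fixes s :: "nat \<Rightarrow> real" and e g :: "nat \<Rightarrow> 'a::chilbert_space"
  assumes "summable s" "\<And>j. 0 \<le> s j" "\<And>j. norm (e j) \<le> 1" "\<And>j. norm (g j) \<le> C"
    and "\<And>x. (\<lambda>j. s j *\<^sub>R (cinner x (e j) *\<^sub>C g j)) sums L x"
  shows "ctrace L = (\<Sum>j. s j *\<^sub>R cinner (g j) (e j))"
  unfolding ctrace_def
proof (rule the_equality)
  obtain B :: "'a set" where B: "orthonormal_basis B" using orthonormal_basis_exists by blast
  fix c assume "\<forall>B. orthonormal_basis B \<longrightarrow> ((\<lambda>e. cinner (L e) e) has_sum c) B"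
  then show "c = (\<Sum>j. s j *\<^sub>R cinner (g j) (e j))"
    using B has_sum_diagonal[OF B assms] has_sum_unique by blast
qed (use has_sum_diagonal[OF _ assms] in blast)

section \<open>Singular value decomposition\<close>

text \<open>The degenerate case is built in: if \<open>K e = 0\<close>, then \<open>K\<close>
  vanishes on \<open>V\<close> and \<open>e = 0\<close>. In this way an operator of finite rank
  yields zero vectors from some index on.\<close>

definition norm_attained_on :: "('a::chilbert_space \<Rightarrow> 'a) \<Rightarrow> 'a set \<Rightarrow> 'a \<Rightarrow> bool" where
  "norm_attained_on K V e \<longleftrightarrow> e \<in> V \<and> norm e = (if K e = 0 then 0 else 1) \<and>
     (\<forall>x\<in>V. norm (K x) \<le> norm (K e) * norm x)"

text \<open>Compactness only makes the images of a maximising sequence converge along a subsequence.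
  The vectors converge too: the images of sums of two of them have norm nearly 2s, so these sums
  have norm nearly 2, and the Cauchy criterion from the parallelogram law applies.\<close>

lemma norm_attained_on_exists:
  fixes K :: "'a::chilbert_space \<Rightarrow> 'a"
  assumes K: "compact_operator K" and V: "complex_vector.subspace V" "closed V"
  shows "\<exists>e. norm_attained_on K V e"
proof -
  have bc: "bounded_clinear K" and cpt: "compact (closure (K ` cball 0 1))"
    using K by (simp_all add: compact_operator_def)
  have bl: "bounded_linear K" using bc by (rule bounded_clinear_imp_bounded_linear)
  define s where "s = (SUP x\<in>V \<inter> cball 0 1. norm (K x))"
  have bdd: "bdd_above ((\<lambda>x. norm (K x)) ` (V \<inter> cball 0 1))"
  proof -
    obtain D where D: "\<And>x. norm (K x) \<le> norm x * D" "D \<ge> 0"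
      using bounded_linear.nonneg_bounded[OF bl] by auto
    have "norm (K x) \<le> D" if "norm x \<le> 1" for x
      using D(1)[of x] mult_right_mono[OF that D(2)] by simp
    then show ?thesis by (intro bdd_aboveI[of _ D]) auto
  qed
  have zero: "0 \<in> V \<inter> cball 0 1" using complex_vector.subspace_0[OF V(1)] by simp
  have s_ge: "norm (K x) \<le> s" if "x \<in> V" "norm x \<le> 1" for x
    unfolding s_def using that by (intro cSUP_upper bdd) auto
  have K0: "K 0 = 0" using bl by (simp add: linear_simps)
  have "s \<ge> 0" using s_ge[of 0] zero K0 by simp
  have s_bound: "norm (K x) \<le> s * norm x" if "x \<in> V" for x
  proof (cases "x = 0")
    case False
    have "(1 / norm x) *\<^sub>R x \<in> V"
      unfolding scaleR_scaleC using V(1) that by (rule complex_vector.subspace_scale)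
    then have "norm (K ((1 / norm x) *\<^sub>R x)) \<le> s" using False by (intro s_ge) auto
    then show ?thesis using False by (simp add: linear_simps[OF bl] pos_divide_le_eq)
  qed (simp add: K0)
  show ?thesis
  proof (cases "s = 0")
    case True
    then show ?thesis using s_bound zero K0 by (auto simp: norm_attained_on_def intro!: exI[of _ 0])
  next
    case False
    with \<open>s \<ge> 0\<close> have "s > 0" by simp
    have "\<exists>x\<in>V \<inter> cball 0 1. s - inverse (real (Suc n)) < norm (K x)" for n
    proof -
      have "V \<inter> cball 0 1 \<noteq> {}" using zero by blast
      from less_cSUP_iff[OF this bdd, of "s - inverse (real (Suc n))"]
      show ?thesis unfolding s_def[symmetric] by (metis diff_less_eq inverse_positive_iff_positive less_add_same_cancel1 of_nat_0_less_iff zero_less_Suc)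
    qed
    then obtain x where x: "\<And>n. x n \<in> V \<inter> cball 0 1"
        "\<And>n. s - inverse (real (Suc n)) < norm (K (x n))" by metis
    have "\<forall>n. K (x n) \<in> closure (K ` cball 0 1)" using x(1) by (intro allI subsetD[OF closure_subset] imageI) auto
    then obtain y r where r: "strict_mono (r :: nat \<Rightarrow> nat)" "((\<lambda>n. K (x n)) \<circ> r) \<longlonglongrightarrow> y"
      using cpt unfolding compact_def by metis
    define u where "u = x \<circ> r"
    have u: "u n \<in> V" "norm (u n) \<le> 1" for n using x(1)[of "r n"] by (auto simp: u_def)
    have Ku: "(\<lambda>n. K (u n)) \<longlonglongrightarrow> y" using r(2) by (simp add: u_def comp_def)
    have "(\<lambda>n. norm (K (x n))) \<longlonglongrightarrow> s"
    proof (rule tendsto_sandwich[where h = "\<lambda>_. s"])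
      show "(\<lambda>n. s - inverse (real (Suc n))) \<longlonglongrightarrow> s"
        using LIMSEQ_inverse_real_of_nat_add_minus[of s] by simp
      show "\<forall>\<^sub>F n in sequentially. norm (K (x n)) \<le> s"
        using x(1) s_ge by (intro always_eventually) auto
    qed (use less_imp_le[OF x(2)] in \<open>simp_all del: of_nat_Suc\<close>)
    from LIMSEQ_subseq_LIMSEQ[OF this r(1)] have "(\<lambda>n. norm (K (u n))) \<longlonglongrightarrow> s"
      by (simp add: u_def comp_def)
    then have ny: "norm y = s" using tendsto_norm[OF Ku] LIMSEQ_unique by blast
    have nu: "(\<lambda>n. norm (u n)) \<longlonglongrightarrow> 1"
    proof (rule tendsto_sandwich[where h = "\<lambda>_. 1"])
      have "(\<lambda>n. norm (K (u n)) / s) \<longlonglongrightarrow> s / s"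
        using \<open>s > 0\<close> \<open>(\<lambda>n. norm (K (u n))) \<longlonglongrightarrow> s\<close> by (intro tendsto_intros) auto
      then show "(\<lambda>n. norm (K (u n)) / s) \<longlonglongrightarrow> 1" using \<open>s > 0\<close> by simp
      show "\<forall>\<^sub>F n in sequentially. norm (K (u n)) / s \<le> norm (u n)"
        using s_bound[OF u(1)] \<open>s > 0\<close>
        by (intro always_eventually) (simp add: pos_divide_le_eq mult.commute)
    qed (use u in auto)
    have "Cauchy u"
    proof (rule Cauchy_if_norm_sum_large[OF nu])
      fix \<epsilon> :: real assume "\<epsilon> > 0"
      then have "s * \<epsilon> / 2 > 0" using \<open>s > 0\<close> by simp
      then obtain N where N: "\<And>n. n \<ge> N \<Longrightarrow> norm (K (u n) - y) < s * \<epsilon> / 2"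
        using LIMSEQ_D[OF Ku] by blast
      have "2 * 1 - \<epsilon> \<le> norm (u m + u n)" if "m \<ge> N" "n \<ge> N" for m n
      proof -
        have "2 * s = norm (2 *\<^sub>R y)" using ny by simp
        also have "2 *\<^sub>R y = K (u m + u n) - (K (u m) - y) - (K (u n) - y)"
          by (simp add: linear_simps[OF bl] scaleR_2)
        also have "norm \<dots> \<le> norm (K (u m + u n)) + s * \<epsilon> / 2 + s * \<epsilon> / 2"
          using N[OF that(1)] N[OF that(2)]
          by (smt (verit) norm_triangle_ineq4)
        also have "norm (K (u m + u n)) \<le> s * norm (u m + u n)"
          using u(1) V(1) by (intro s_bound complex_vector.subspace_add)
        finally have "s * (2 - \<epsilon>) \<le> s * norm (u m + u n)" by (simp add: algebra_simps)
        then show ?thesis using \<open>s > 0\<close> by simp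
      qed
      then show "\<exists>N. \<forall>m\<ge>N. \<forall>n\<ge>N. 2 * 1 - \<epsilon> \<le> norm (u m + u n)" by blast
    qed
    then obtain e where e: "u \<longlonglongrightarrow> e" using Cauchy_convergent_iff convergent_def by blast
    have "e \<in> V" using closed_sequentially[OF V(2) u(1) e] .
    moreover have "norm e = 1" using tendsto_norm[OF e] nu LIMSEQ_unique by blast
    moreover have "K e = y"
      using bounded_linear.tendsto[OF bl e] Ku LIMSEQ_unique by blast
    ultimately show ?thesis
      using ny \<open>s > 0\<close> s_bound by (auto simp: norm_attained_on_def intro!: exI[of _ e])
  qed
qed

text \<open>Since \<open>x\<close> is orthogonal to \<open>e\<close>, adding
  \<open>c *\<^sub>C x\<close> changes the squared norm of \<open>e\<close> only at second order in
  \<open>c\<close>, whereas the squared norm of the image has the first-order term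
  \<open>2 * Re (cnj c * cinner (K e) (K x))\<close>. At a maximiser that term must vanish.\<close>

lemma norm_attained_on_orthogonal:
  assumes K: "bounded_clinear K" and V: "complex_vector.subspace V"
    and e: "norm_attained_on K V e" and x: "x \<in> V" "cinner e x = 0"
  shows "cinner (K e) (K x) = 0"
proof (rule eq_0_if_quadratic_bound)
  fix c
  let ?s = "norm (K e)"
  have "e + c *\<^sub>C x \<in> V"
    using e x V unfolding norm_attained_on_def
    by (intro complex_vector.subspace_scale complex_vector.subspace_add) auto
  then have "norm (K (e + c *\<^sub>C x)) \<le> ?s * norm (e + c *\<^sub>C x)"
    using e by (simp add: norm_attained_on_def)
  then have "(norm (K (e + c *\<^sub>C x)))\<^sup>2 \<le> ?s\<^sup>2 * (norm (e + c *\<^sub>C x))\<^sup>2"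
    unfolding power_mult_distrib[symmetric] by (intro power_mono) auto
  moreover have "(norm e)\<^sup>2 \<le> 1" using e by (simp add: norm_attained_on_def)
  then have "?s\<^sup>2 * (norm (e + c *\<^sub>C x))\<^sup>2 \<le> ?s\<^sup>2 * (1 + (cmod c)\<^sup>2 * (norm x)\<^sup>2)"
    using x(2) by (intro mult_left_mono)
      (simp_all add: power2_norm_add norm_scaleC power_mult_distrib cinner_scaleC_right)
  moreover have "(norm (K (e + c *\<^sub>C x)))\<^sup>2 = ?s\<^sup>2 + (norm (c *\<^sub>C K x))\<^sup>2 + 2 * Re (cnj c * cinner (K e) (K x))"
    using K by (simp add: bounded_clinear_add bounded_clinear_scaleC power2_norm_add cinner_scaleC_right)
  moreover have "0 \<le> (norm (c *\<^sub>C K x))\<^sup>2" by simp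
  ultimately show "2 * Re (cnj c * cinner (K e) (K x)) \<le> (cmod c)\<^sup>2 * (?s\<^sup>2 * (norm x)\<^sup>2)"
    unfolding distrib_left mult_1_right mult.left_commute[of "?s\<^sup>2"] by linarith
qed

text \<open>The Schmidt expansion. Zero vectors stand exactly where \<open>s j = 0\<close>, so the
  indices of a positive value count the vectors that span its eigenspace.\<close>

definition singular_decomposition ::
  "('a::complex_inner \<Rightarrow> 'a) \<Rightarrow> (nat \<Rightarrow> real) \<Rightarrow> (nat \<Rightarrow> 'a) \<Rightarrow> (nat \<Rightarrow> 'a) \<Rightarrow> bool" where
  "singular_decomposition K s e f \<longleftrightarrow> antimono s \<and> s \<longlonglongrightarrow> 0 \<and>
     orthonormal_family e \<and> orthonormal_family f \<and>
     (\<forall>j. e j = 0 \<longleftrightarrow> s j = 0) \<and> (\<forall>j. f j = 0 \<longleftrightarrow> s j = 0) \<and>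
     (\<forall>x. (\<lambda>j. s j *\<^sub>R (cinner x (e j) *\<^sub>C f j)) sums K x)"

text \<open>
  A maximiser of \<open>\<parallel>K x\<parallel>\<close> is split off repeatedly from the orthogonal complement of the previous ones;
  the images of the maximisers are orthogonal by \<open>norm_attained_on_orthogonal\<close>, so neither the adjoint
  nor the spectral theorem is needed.
\<close>

lemma singular_decomposition_exists:
  fixes K :: "'a::chilbert_space \<Rightarrow> 'a"
  assumes K: "compact_operator K"
  shows "\<exists>s e f. singular_decomposition K s e f"
proof -
  have bc: "bounded_clinear K" and cpt: "compact (closure (K ` cball 0 1))"
    using K by (simp_all add: compact_operator_def)
  have bl: "bounded_linear K" using bc by (rule bounded_clinear_imp_bounded_linear)
  define m where "m V = (SOME e. norm_attained_on K V e)" for V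
  \<comment> \<open>The recursion runs over subspaces, from which the vectors are then chosen;
    \<open>V n\<close> is the orthogonal complement of the first \<open>n\<close> of them.\<close>
  define V where "V = rec_nat UNIV (\<lambda>_ W. W \<inter> {x. cinner x (m W) = 0})"
  define e where "e n = m (V n)" for n
  define s where "s n = norm (K (e n))" for n
  define f where "f n = (1 / s n) *\<^sub>R K (e n)" for n
  have V_iff: "x \<in> V n \<longleftrightarrow> (\<forall>j<n. cinner x (e j) = 0)" for x n
    by (induction n) (auto simp: V_def e_def less_Suc_eq)
  have sub: "complex_vector.subspace (V n)" for n
    by (rule complex_vector.subspaceI) (simp_all add: V_iff cinner_simps cinner.zero_left)
  have "closed {x. cinner x y = 0}" for y :: 'a
    by (intro closed_Collect_eq continuous_intros cinner.continuous)
      (auto intro!: continuous_on_id cinner.continuous_on continuous_on_const)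
  then have clo: "closed (V n)" for n
  proof -
    have "V n = (\<Inter>j\<in>{..<n}. {x. cinner x (e j) = 0})" using V_iff by auto
    then show ?thesis using \<open>\<And>y. closed {x. cinner x y = 0}\<close> by auto
  qed
  have att: "norm_attained_on K (V n) (e n)" for n
    unfolding e_def m_def by (rule someI_ex) (rule norm_attained_on_exists[OF K sub clo])
  have s_nn: "s n \<ge> 0" for n by (simp add: s_def)
  have Ve: "e j \<in> V i" if "i \<le> j" for i j
    using att[of j] that by (auto simp: norm_attained_on_def V_iff)
  have norm_e: "norm (e n) = (if s n = 0 then 0 else 1)" for n
    using att[of n] by (simp add: norm_attained_on_def s_def)
  have bound: "norm (K x) \<le> s n * norm x" if "x \<in> V n" for x n
    using att[of n] that by (simp add: norm_attained_on_def s_def)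
  have e0: "e n = 0 \<longleftrightarrow> s n = 0" for n
    using norm_e[of n] by (metis norm_eq_zero zero_neq_one)
  have e_orth: "cinner (e i) (e j) = 0" if "i < j" for i j
    using Ve[of j j] that by (simp add: V_iff cinner_eq_0_commute[of "e i"])
  have Ke_orth: "cinner (K (e i)) (K (e j)) = 0" if "i < j" for i j
    using norm_attained_on_orthogonal[OF bc sub att Ve e_orth[OF that]] that by simp
  have e: "orthonormal_family e"
    unfolding orthonormal_family_def
  proof (intro allI)
    fix i j
    show "cinner (e i) (e j) = (if i = j \<and> e i \<noteq> 0 then 1 else 0)"
      using e_orth[of i j] e_orth[of j i] cinner_eq_0_commute[of "e i" "e j"]
        cinner_self[of "e i"] norm_e[of i] e0[of i] by (cases i j rule: linorder_cases) auto
  qed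
  have f0: "f n = 0 \<longleftrightarrow> s n = 0" for n by (auto simp: f_def s_def)
  have f: "orthonormal_family f"
    unfolding orthonormal_family_def
  proof (intro allI)
    fix i j
    have "norm (f i) = (if s i = 0 then 0 else 1)" by (simp add: f_def s_def)
    then show "cinner (f i) (f j) = (if i = j \<and> f i \<noteq> 0 then 1 else 0)"
      using Ke_orth[of i j] Ke_orth[of j i] cinner_eq_0_commute[of "K (e i)" "K (e j)"]
        cinner_self[of "f i"] f0[of i]
      by (cases i j rule: linorder_cases) (auto simp: f_def cinner_simps)
  qed
  have anti: "antimono s"
  proof (rule antimonoI)
    fix i j :: nat assume "i \<le> j"
    have "s j \<le> s i * norm (e j)" using bound[OF Ve[OF \<open>i \<le> j\<close>]] by (simp add: s_def)
    also have "\<dots> \<le> s i * 1" using s_nn norm_e[of j] by (intro mult_left_mono) auto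
    finally show "s j \<le> s i" by simp
  qed
  have lim: "s \<longlonglongrightarrow> 0"
  proof -
    have "decseq s" using anti by (simp add: decseq_def antimono_def)
    obtain l where l: "s \<longlonglongrightarrow> l" "\<And>n. l \<le> s n"
      using decseq_convergent[OF \<open>decseq s\<close>, of 0] s_nn by auto
    have "l \<ge> 0" using l(1) s_nn by (intro LIMSEQ_le_const) auto
    \<comment> \<open>Otherwise the vectors \<open>K (e n)\<close> would be orthogonal with norms at
      least \<open>l\<close>, hence at mutual distance at least \<open>l\<close>, against the
      convergence of a subsequence.\<close>
    have "\<not> l > 0"
    proof
      assume "l > 0"
      have "\<forall>n. K (e n) \<in> closure (K ` cball 0 1)"
        using norm_e by (intro allI subsetD[OF closure_subset] imageI) (auto split: if_splits)
      then obtain y r where r: "strict_mono (r :: nat \<Rightarrow> nat)" "((\<lambda>n. K (e n)) \<circ> r) \<longlonglongrightarrow> y"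
        using cpt unfolding compact_def by metis
      from LIMSEQ_imp_Cauchy[OF r(2)] obtain N where
        N: "\<And>m n. m \<ge> N \<Longrightarrow> n \<ge> N \<Longrightarrow> dist (K (e (r m))) (K (e (r n))) < l"
        using \<open>l > 0\<close> unfolding Cauchy_def comp_def by metis
      have "r N < r (Suc N)" using r(1) by (simp add: strict_mono_Suc_iff)
      then have "(norm (K (e (r N)) - K (e (r (Suc N)))))\<^sup>2 = (s (r N))\<^sup>2 + (s (r (Suc N)))\<^sup>2"
        using power2_norm_add[of "K (e (r N))" "- K (e (r (Suc N)))"] Ke_orth
        by (simp add: cinner_simps s_def)
      moreover have "l\<^sup>2 \<le> (s (r N))\<^sup>2" using l \<open>l \<ge> 0\<close> by (intro power_mono) auto
      moreover have "0 \<le> (s (r (Suc N)))\<^sup>2" by simp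
      ultimately have "l\<^sup>2 \<le> (norm (K (e (r N)) - K (e (r (Suc N)))))\<^sup>2" by linarith
      then have "l \<le> norm (K (e (r N)) - K (e (r (Suc N))))" by (rule power2_le_imp_le) simp
      then show False using N[of N "Suc N"] by (simp add: dist_norm)
    qed
    with l \<open>l \<ge> 0\<close> show ?thesis by simp
  qed
  have "(\<lambda>j. s j *\<^sub>R (cinner x (e j) *\<^sub>C f j)) sums K x" for x
  proof -
    define P where "P n = (\<Sum>j<n. cinner x (e j) *\<^sub>C e j)" for n
    have KP: "K (P n) = (\<Sum>j<n. s j *\<^sub>R (cinner x (e j) *\<^sub>C f j))" for n
    proof -
      have "s j *\<^sub>R (cinner x (e j) *\<^sub>C f j) = K (cinner x (e j) *\<^sub>C e j)" for j
        using e0[of j] by (cases "s j = 0")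
          (simp_all add: bounded_clinear_scaleC[OF bc] linear_simps[OF bl] f_def
            cinner.zero_right scaleC.scaleR_right scaleC.zero_right)
      then show ?thesis
        by (simp add: P_def linear_sum[OF bounded_linear.linear[OF bl]])
    qed
    \<comment> \<open>The remainder \<open>x - P n\<close> lies in \<open>V n\<close>, where
      \<open>s n\<close> bounds \<open>K\<close>; hence the error of the expansion tends to
      0.\<close>
    have "norm (K (x - P n)) \<le> s n * norm x" for n
    proof -
      have "cinner (P n) (e i) = cinner x (e i)" if "i < n" for i
      proof -
        have "cinner (P n) (e i) = (\<Sum>j<n. if j = i then cinner x (e i) else 0)"
          unfolding P_def cinner.sum_left
          using orthonormal_familyD[OF e] by (intro sum.cong) (auto simp: cinner_simps cinner.zero_right)
        then show ?thesis using that by simp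
      qed
      then have "x - P n \<in> V n" by (simp add: V_iff cinner_simps)
      then have "norm (K (x - P n)) \<le> s n * norm (x - P n)" by (rule bound)
      also have "(norm (x - P n))\<^sup>2 \<le> (norm x)\<^sup>2"
        unfolding P_def using Bessel[OF e, of "{..<n}" x] by (simp add: sum_nonneg)
      then have "norm (x - P n) \<le> norm x" by (rule power2_le_imp_le) simp
      finally show ?thesis using s_nn by (simp add: mult_left_mono)
    qed
    then have "(\<lambda>n. K (x - P n)) \<longlonglongrightarrow> 0"
      using tendsto_mult_left_zero[OF lim, of "norm x"]
      by (rule Lim_null_comparison[OF always_eventually[OF allI]])
    from tendsto_diff[OF tendsto_const this, of "K x"]
    have "(\<lambda>n. K x - K (x - P n)) \<longlonglongrightarrow> K x" by simp
    then show ?thesis 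
      unfolding bounded_clinear_diff[OF bc] sums_def KP[symmetric] by simp
  qed
  with anti lim e f e0 f0 show ?thesis unfolding singular_decomposition_def by blast
qed

section \<open>Operators given by a diagonal series\<close>

lemma antimono_null_nonneg:
  fixes s :: "nat \<Rightarrow> real"
  assumes "antimono s" "s \<longlonglongrightarrow> 0"
  shows "0 \<le> s n"
  using decseq_ge[of s 0 n] assms by (simp add: decseq_def antimono_def)

definition diagonal_operator ::
  "(nat \<Rightarrow> real) \<Rightarrow> (nat \<Rightarrow> 'a::chilbert_space) \<Rightarrow> (nat \<Rightarrow> 'a) \<Rightarrow> 'a \<Rightarrow> 'a" where
  "diagonal_operator s e f x = (\<Sum>j. s j *\<^sub>R (cinner x (e j) *\<^sub>C f j))"

text \<open>Gives access to the Cauchy criterion for series of vectors.\<close>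

instance chilbert_space \<subseteq> banach ..

locale diagonal =
  fixes s :: "nat \<Rightarrow> real" and e f :: "nat \<Rightarrow> 'a::chilbert_space"
  assumes anti: "antimono s" and null: "s \<longlonglongrightarrow> 0"
    and e: "orthonormal_family e" and f: "orthonormal_family f"
begin

lemma s_nonneg: "0 \<le> s n"
  by (rule antimono_null_nonneg[OF anti null])

text \<open>Orthonormality of \<open>f\<close> reduces the block to its coefficients, monotonicity
  extracts \<open>s m\<close>, and Bessel's inequality for \<open>e\<close> bounds the rest. The
  bound is uniform on the unit ball, which later yields compactness.\<close>

lemma norm_block_le:
  "norm (\<Sum>j\<in>{m..<n}. s j *\<^sub>R (cinner x (e j) *\<^sub>C f j)) \<le> s m * norm x"
proof (rule power2_le_imp_le)
  have "(norm (\<Sum>j\<in>{m..<n}. s j *\<^sub>R (cinner x (e j) *\<^sub>C f j)))\<^sup>2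
      \<le> (\<Sum>j\<in>{m..<n}. (cmod (complex_of_real (s j) * cinner x (e j)))\<^sup>2)"
    unfolding scaleR_scaleC scaleC_scaleC by (rule Pythagoras_sum[OF f]) simp
  also have "\<dots> \<le> (\<Sum>j\<in>{m..<n}. (s m)\<^sup>2 * (cmod (cinner x (e j)))\<^sup>2)"
    using antimonoD[OF anti] s_nonneg
    by (intro sum_mono) (auto simp: norm_mult power_mult_distrib intro!: mult_right_mono power_mono)
  also have "\<dots> = (s m)\<^sup>2 * (\<Sum>j\<in>{m..<n}. (cmod (cinner x (e j)))\<^sup>2)" by (simp add: sum_distrib_left)
  also have "\<dots> \<le> (s m)\<^sup>2 * (norm x)\<^sup>2" by (intro mult_left_mono Bessel_inequality[OF e]) simp
  finally show "(norm (\<Sum>j\<in>{m..<n}. s j *\<^sub>R (cinner x (e j) *\<^sub>C f j)))\<^sup>2 \<le> (s m * norm x)\<^sup>2"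
    by (simp add: power_mult_distrib)
qed (simp add: s_nonneg)

lemma sums_operator: "(\<lambda>j. s j *\<^sub>R (cinner x (e j) *\<^sub>C f j)) sums diagonal_operator s e f x"
proof -
  have "summable (\<lambda>j. s j *\<^sub>R (cinner x (e j) *\<^sub>C f j))"
    unfolding summable_Cauchy
  proof (intro allI impI)
    fix \<epsilon> :: real assume "\<epsilon> > 0"
    have "(\<lambda>n. s n * norm x) \<longlonglongrightarrow> 0" by (rule tendsto_mult_left_zero[OF null])
    then have "\<forall>\<^sub>F n in sequentially. s n * norm x < \<epsilon>" using \<open>\<epsilon> > 0\<close> by (rule order_tendstoD)
    then obtain N where N: "\<And>n. n \<ge> N \<Longrightarrow> s n * norm x < \<epsilon>"
      unfolding eventually_sequentially by blast
    show "\<exists>N. \<forall>m\<ge>N. \<forall>n. norm (\<Sum>j = m..<n. s j *\<^sub>R (cinner x (e j) *\<^sub>C f j)) < \<epsilon>"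
      using N norm_block_le le_less_trans by blast
  qed
  then show ?thesis unfolding diagonal_operator_def by (rule summable_sums)
qed

lemma norm_tail_le:
  "norm (diagonal_operator s e f x - (\<Sum>j<n. s j *\<^sub>R (cinner x (e j) *\<^sub>C f j))) \<le> s n * norm x"
proof (rule LIMSEQ_le_const2)
  let ?a = "\<lambda>j. s j *\<^sub>R (cinner x (e j) *\<^sub>C f j)"
  have "(\<lambda>N. sum ?a {..<N}) \<longlonglongrightarrow> diagonal_operator s e f x"
    using sums_operator[of x] by (simp add: sums_def)
  from tendsto_norm[OF tendsto_diff[OF this tendsto_const]]
  show "(\<lambda>N. norm (sum ?a {..<N} - sum ?a {..<n}))
      \<longlonglongrightarrow> norm (diagonal_operator s e f x - sum ?a {..<n})" .
  have "norm (sum ?a {..<N} - sum ?a {..<n}) \<le> s n * norm x" if "N \<ge> n" for N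
  proof -
    have "sum ?a {..<N} - sum ?a {..<n} = sum ?a {n..<N}"
      using sum_diff_nat_ivl[of 0 n N ?a] that by (simp add: atLeast0LessThan)
    then show ?thesis using norm_block_le by simp
  qed
  then show "\<exists>N. \<forall>k\<ge>N. norm (sum ?a {..<k} - sum ?a {..<n}) \<le> s n * norm x" by blast
qed

lemma bounded_clinear_operator: "bounded_clinear (diagonal_operator s e f)"
proof -
  have add: "diagonal_operator s e f (x + y) = diagonal_operator s e f x + diagonal_operator s e f y" for x y
    using sums_add[OF sums_operator[of x] sums_operator[of y]] sums_operator[of "x + y"]
    by (intro sums_unique2[OF sums_operator[of "x + y"]])
      (simp add: cinner_simps scaleC.add_left scaleR_add_right)
  have scale: "diagonal_operator s e f (c *\<^sub>C x) = c *\<^sub>C diagonal_operator s e f x" for c x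
    using bounded_linear.sums[OF scaleC.bounded_linear_right[of c] sums_operator[of x]]
    by (intro sums_unique2[OF sums_operator[of "c *\<^sub>C x"]])
      (simp add: cinner_simps scaleR_scaleC scaleC_scaleC mult_ac)
  have "bounded_linear (diagonal_operator s e f)"
  proof (rule bounded_linear_intro[where K = "s 0"])
    show "norm (diagonal_operator s e f x) \<le> norm x * s 0" for x
      using norm_tail_le[of x 0] by (simp add: mult.commute)
  qed (simp_all add: add scale scaleR_scaleC)
  with scale show ?thesis by (simp add: bounded_clinear_def)
qed

text \<open>The operator is a uniform limit, on the unit ball, of finite partial sums with
  relatively compact images; so its image of the ball is totally bounded.\<close>

lemma compact_operator_operator: "compact_operator (diagonal_operator s e f)"
proof -
  let ?D = "diagonal_operator s e f"
  \<comment> \<open>One compact set has to serve all \<open>x\<close> in the ball: each new term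
    ranges over a continuous image of the closed unit disc of scalars.\<close>
  have rank: "\<exists>C. compact C \<and> (\<forall>x\<in>cball 0 1. (\<Sum>j<n. s j *\<^sub>R (cinner x (e j) *\<^sub>C f j)) \<in> C)" for n
  proof (induction n)
    case 0
    show ?case by (intro exI[of _ "{0}"]) simp
  next
    case (Suc n)
    then obtain C where C: "compact C"
      "\<And>x. x \<in> cball 0 1 \<Longrightarrow> (\<Sum>j<n. s j *\<^sub>R (cinner x (e j) *\<^sub>C f j)) \<in> C" by blast
    let ?E = "(\<lambda>c. s n *\<^sub>R (c *\<^sub>C f n)) ` cball 0 1"
    have "compact ?E"
      by (intro compact_continuous_image continuous_intros scaleC.continuous_on compact_cball)
    then have "compact {a + b | a b. a \<in> C \<and> b \<in> ?E}" using C(1) by (rule compact_sums[rotated])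
    moreover have "cinner x (e n) \<in> cball 0 1" if "x \<in> cball 0 1" for x
      using that cinner_Cauchy_Schwarz[of x "e n"] norm_orthonormal_family_le[OF e, of n]
        mult_mono[of "norm x" 1 "norm (e n)" 1] by simp
    ultimately show ?case
      using C(2) by (intro exI[of _ "{a + b | a b. a \<in> C \<and> b \<in> ?E}"]) fastforce
  qed
  have "\<exists>k. finite k \<and> closure (?D ` cball 0 1) \<subseteq> (\<Union>x\<in>k. ball x \<epsilon>)" if "\<epsilon> > 0" for \<epsilon>
  proof -
    \<comment> \<open>One quarter pays for the tail and one for the net of the partial sums. The
      resulting closed balls of radius \<epsilon>/2 still cover the closure and fit into the open
      balls of radius \<epsilon>.\<close>
    have "\<forall>\<^sub>F n in sequentially. s n < \<epsilon> / 4" using order_tendstoD(2)[OF null, of "\<epsilon> / 4"] that by simp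
    then obtain n where n: "s n < \<epsilon> / 4" by (auto simp: eventually_sequentially)
    obtain C where C: "compact C"
      "\<And>x. x \<in> cball 0 1 \<Longrightarrow> (\<Sum>j<n. s j *\<^sub>R (cinner x (e j) *\<^sub>C f j)) \<in> C" using rank[of n] by blast
    have "0 < \<epsilon> / 4" using that by simp
    then obtain k where k: "finite k" "C \<subseteq> (\<Union>x\<in>k. ball x (\<epsilon> / 4))"
      using C(1) unfolding compact_eq_totally_bounded by blast
    have "?D x \<in> (\<Union>x\<in>k. cball x (\<epsilon> / 2))" if x: "x \<in> cball 0 1" for x
    proof -
      let ?y = "\<Sum>j<n. s j *\<^sub>R (cinner x (e j) *\<^sub>C f j)"
      obtain z where z: "z \<in> k" "dist z ?y < \<epsilon> / 4" using k(2) C(2)[OF x] by auto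
      have "dist ?y (?D x) \<le> s n * norm x"
        using norm_tail_le[of x n] by (simp add: dist_norm norm_minus_commute)
      also have "\<dots> \<le> s n * 1" using x s_nonneg by (intro mult_left_mono) auto
      finally have "dist z (?D x) \<le> \<epsilon> / 2" using dist_triangle[of z "?D x" ?y] z(2) n by simp
      with z(1) show ?thesis by auto
    qed
    then have "closure (?D ` cball 0 1) \<subseteq> (\<Union>x\<in>k. cball x (\<epsilon> / 2))"
      using k(1) by (intro closure_minimal closed_UN) auto
    also have "\<dots> \<subseteq> (\<Union>x\<in>k. ball x \<epsilon>)" using \<open>\<epsilon> > 0\<close> by (intro UN_mono) auto
    finally show ?thesis using k(1) by blast
  qed
  then have "compact (closure (?D ` cball 0 1))"
    unfolding compact_eq_totally_bounded by (simp add: complete_eq_closed)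
  then show ?thesis using bounded_clinear_operator by (simp add: compact_operator_def)
qed

lemma cinner_operator:
  "cinner (diagonal_operator s e f x) (f i) = (if f i = 0 then 0 else complex_of_real (s i) * cinner x (e i))"
    (is "_ = ?v")
proof (rule sums_unique2)
  show "(\<lambda>j. cinner (s j *\<^sub>R (cinner x (e j) *\<^sub>C f j)) (f i)) sums cinner (diagonal_operator s e f x) (f i)"
    by (rule bounded_linear.sums[OF cinner.bounded_linear_left sums_operator])
  have "(\<lambda>j. cinner (s j *\<^sub>R (cinner x (e j) *\<^sub>C f j)) (f i)) = (\<lambda>j. if j = i then ?v else 0)"
    using orthonormal_familyD[OF f] by (auto simp: fun_eq_iff cinner_simps scaleR_conv_of_real)
  then show "(\<lambda>j. cinner (s j *\<^sub>R (cinner x (e j) *\<^sub>C f j)) (f i)) sums ?v"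
    using sums_single[of i "\<lambda>_. ?v"] by simp
qed

text \<open>Exchanging the two families gives the adjoint of each rank one term, as the
  \<open>s j\<close> are real; the description in \<open>cadjoint\<close> has one solution because
  inner products separate vectors.\<close>

lemma cadjoint_operator: "cadjoint (diagonal_operator s e f) = diagonal_operator s f e"
proof -
  interpret adj: diagonal s f e using anti null e f by unfold_locales
  have adj: "cinner (diagonal_operator s e f x) y = cinner x (diagonal_operator s f e y)" for x y
  proof (rule sums_unique2)
    show "(\<lambda>j. cinner (s j *\<^sub>R (cinner x (e j) *\<^sub>C f j)) y) sums cinner (diagonal_operator s e f x) y"
      by (rule bounded_linear.sums[OF cinner.bounded_linear_left sums_operator])
    have "(\<lambda>j. cinner x (s j *\<^sub>R (cinner y (f j) *\<^sub>C e j))) sums cinner x (diagonal_operator s f e y)"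
      by (rule bounded_linear.sums[OF cinner.bounded_linear_right adj.sums_operator])
    moreover have "cnj (cinner y (f j)) = cinner (f j) y" for j by (rule cinner_commute[symmetric])
    ultimately show "(\<lambda>j. cinner (s j *\<^sub>R (cinner x (e j) *\<^sub>C f j)) y) sums cinner x (diagonal_operator s f e y)"
      by (simp add: cinner_simps mult_ac)
  qed
  show ?thesis
    unfolding cadjoint_def
  proof (rule the_equality)
    fix S assume S: "\<forall>x y. cinner (diagonal_operator s e f x) y = cinner x (S y)"
    show "S = diagonal_operator s f e"
      by (rule ext, rule cinner_ext) (metis S adj)
  qed (use adj in blast)
qed

end

lemma singular_decompositionD:
  assumes "singular_decomposition K s e f"
  shows "diagonal s e f" and "K = diagonal_operator s e f"
    and "e j = 0 \<longleftrightarrow> s j = 0" and "f j = 0 \<longleftrightarrow> s j = 0"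
    and "(\<lambda>j. s j *\<^sub>R (cinner x (e j) *\<^sub>C f j)) sums K x"
    and "antimono s" and "s \<longlonglongrightarrow> 0" and "orthonormal_family e" and "orthonormal_family f"
  using assms unfolding singular_decomposition_def diagonal_def
  by (auto simp: diagonal_operator_def fun_eq_iff sums_unique)

lemma singular_decomposition_diagonal_operator:
  assumes "diagonal s e f" "\<And>j. e j = 0 \<longleftrightarrow> s j = 0" "\<And>j. f j = 0 \<longleftrightarrow> s j = 0"
  shows "singular_decomposition (diagonal_operator s e f) s e f"
  using assms diagonal.sums_operator[OF assms(1)]
  unfolding singular_decomposition_def diagonal_def by blast

section \<open>Singular values are determined by multiplicities\<close>

lemma finite_level_set:
  fixes s :: "nat \<Rightarrow> real"
  assumes "s \<longlonglongrightarrow> 0" "t > 0"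
  shows "finite {j. s j = t}"
proof -
  obtain N where "\<And>n. n \<ge> N \<Longrightarrow> s n < t"
    using order_tendstoD(2)[OF assms] by (auto simp: eventually_sequentially)
  then have "{j. s j = t} \<subseteq> {..<N}" by (force simp: not_le[symmetric])
  then show ?thesis by (rule finite_subset) simp
qed

text \<open>Let n be the first index of disagreement, with \<open>s' n < s n\<close>. The sequence
  \<open>s'\<close> takes the value \<open>s n\<close> only below n, where both agree, while
  \<open>s\<close> also takes it at n. Positive level sets are finite, so their cardinalities
  differ. This is the uniqueness half of \<open>singular_value\<close>.\<close>

lemma null_sequence_eqI:
  fixes s s' :: "nat \<Rightarrow> real"
  assumes s: "antimono s" "s \<longlonglongrightarrow> 0" and s': "antimono s'" "s' \<longlonglongrightarrow> 0"
    and card: "\<And>t. t > 0 \<Longrightarrow> card {j. s j = t} = card {j. s' j = t}"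
  shows "s = s'"
proof -
  have not_less: "\<not> s' n < s n"
    if s: "antimono s" "s \<longlonglongrightarrow> 0" and s': "antimono s'" "s' \<longlonglongrightarrow> 0"
      and card: "\<And>t. t > 0 \<Longrightarrow> card {j. s j = t} = card {j. s' j = t}"
      and eq: "\<And>j. j < n \<Longrightarrow> s j = s' j" for s s' :: "nat \<Rightarrow> real" and n
  proof
    assume less: "s' n < s n"
    then have pos: "s n > 0" using antimono_null_nonneg[OF s', of n] by simp
    have "j < n" if "s' j = s n" for j
      using that less antimonoD[OF s'(1), of n j] by (cases "j < n") auto
    then have "{j. s' j = s n} \<subseteq> {j. s j = s n} - {n}" using eq by auto
    also have "\<dots> \<subset> {j. s j = s n}" by auto
    finally have "card {j. s' j = s n} < card {j. s j = s n}"
      using finite_level_set[OF s(2) pos] by (intro psubset_card_mono) auto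
    with card[OF pos] show False by simp
  qed
  have "s n = s' n" for n
  proof (induction n rule: less_induct)
    case (less n)
    then show ?case
      using not_less[OF s s' card] not_less[OF s' s card[symmetric]] by (metis linorder_neqE_linordered_idom)
  qed
  then show ?thesis by blast
qed

text \<open>The operator \<open>cadjoint K \<circ> K\<close> is diagonal in \<open>e\<close> with
  entries \<open>(s j)\<^sup>2\<close>, so its eigenspace for \<open>t\<^sup>2\<close> with
  \<open>t > 0\<close> is spanned by the independent vectors \<open>e j\<close> with
  \<open>s j = t\<close>. Thus \<open>s\<close> satisfies the counting description.\<close>

lemma singular_value_eq:
  assumes K: "singular_decomposition K s e f"
  shows "singular_value K = s"
proof -
  note D = singular_decompositionD[OF K]
  interpret diagonal s e f by (rule D(1))
  interpret sq: diagonal "\<lambda>j. (s j)\<^sup>2" e e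
  proof
    show "antimono (\<lambda>j. (s j)\<^sup>2)"
      using antimonoD[OF anti] s_nonneg by (auto intro!: antimonoI power_mono)
    show "(\<lambda>j. (s j)\<^sup>2) \<longlonglongrightarrow> 0" by (rule tendsto_eq_rhs[OF tendsto_power[OF null]]) simp
  qed (rule e)+
  let ?D = "diagonal_operator (\<lambda>j. (s j)\<^sup>2) e e"
  have KK: "cadjoint K (K x) = ?D x" for x
  proof -
    have coeff: "cinner (K x) (f i) = complex_of_real (s i) * cinner x (e i)" for i
      using cinner_operator[of x i] D(2-4) by auto
    have "cadjoint K (K x) = diagonal_operator s f e (K x)"
      using cadjoint_operator D(2) by simp
    also have "\<dots> = ?D x"
      unfolding diagonal_operator_def coeff
      by (simp add: scaleR_scaleC scaleC_scaleC power2_eq_square mult.assoc)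
    finally show ?thesis .
  qed
  have dim: "card {j. s j = t} =
      complex_vector.dim {x. cadjoint K (K x) = complex_of_real (t\<^sup>2) *\<^sub>C x}" if "t > 0" for t
  proof -
    define J where "J = {j. s j = t}"
    define E where "E = {x. ?D x = complex_of_real (t\<^sup>2) *\<^sub>C x}"
    have "finite J" unfolding J_def by (rule finite_level_set[OF null \<open>t > 0\<close>])
    have eJ: "e j \<noteq> 0" if "j \<in> J" for j using that D(3)[of j] \<open>t > 0\<close> by (auto simp: J_def)
    have inj: "inj_on e J"
    proof (rule inj_onI)
      fix i j assume "i \<in> J" "j \<in> J" "e i = e j"
      then show "i = j"
        using orthonormal_familyD[OF e, of i j] orthonormal_familyD[OF e, of i i] eJ
        by (auto split: if_splits)
    qed
    have subE: "complex_vector.subspace E"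
      using sq.bounded_clinear_operator
      by (intro complex_vector.subspaceI)
        (auto simp: E_def bounded_clinear_add bounded_clinear_scaleC scaleC.add_right scaleC_scaleC
          mult.commute scaleC.zero_right linear_0 bounded_linear.linear bounded_clinear_imp_bounded_linear)
    have single: "?D x = (\<Sum>j\<in>J. complex_of_real ((s j)\<^sup>2) *\<^sub>C (cinner x (e j) *\<^sub>C e j))"
      if "\<And>j. j \<notin> J \<Longrightarrow> cinner x (e j) = 0" for x
      unfolding diagonal_operator_def scaleR_scaleC
      using that by (intro suminf_finite \<open>finite J\<close>) (simp add: scaleC.zero_left scaleC.zero_right)
    have "E \<subseteq> complex_vector.span (e ` J)"
    proof
      fix x assume x: "x \<in> E"
      \<comment> \<open>Comparing coefficients in the eigenvalue equation;
        \<open>(s i)\<^sup>2 = t\<^sup>2\<close> would give \<open>s i = t\<close>, both being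
        nonnegative.\<close>
      have "cinner x (e i) = 0" if "i \<notin> J" for i
      proof (cases "s i = 0")
        case True
        then show ?thesis using D(3)[of i] by (simp add: cinner.zero_right)
      next
        case False
        then have "cinner (?D x) (e i) = complex_of_real ((s i)\<^sup>2) * cinner x (e i)"
          using sq.cinner_operator[of x i] D(3)[of i] by simp
        then have "complex_of_real ((s i)\<^sup>2 - t\<^sup>2) * cinner x (e i) = 0"
          using x by (auto simp add: E_def cinner_simps left_diff_distrib)
        moreover have "(s i)\<^sup>2 \<noteq> t\<^sup>2"
          using that s_nonneg[of i] \<open>t > 0\<close> by (auto simp: J_def power2_eq_iff)
        ultimately show ?thesis by (simp del: of_real_diff of_real_power)
      qed
      \<comment> \<open>As \<open>t > 0\<close>, the eigenvalue equation writes \<open>x\<close>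
        itself as a finite combination, although \<open>e\<close> may span only part of the
        space.\<close>
      then have "complex_of_real (t\<^sup>2) *\<^sub>C x = (\<Sum>j\<in>J. complex_of_real ((s j)\<^sup>2) *\<^sub>C (cinner x (e j) *\<^sub>C e j))"
        using single[of x] x by (simp add: E_def)
      also have "\<dots> \<in> complex_vector.span (e ` J)"
        by (intro complex_vector.span_sum complex_vector.span_scale complex_vector.span_base) auto
      finally have "(1 / complex_of_real (t\<^sup>2)) *\<^sub>C (complex_of_real (t\<^sup>2) *\<^sub>C x) \<in> complex_vector.span (e ` J)"
        by (rule complex_vector.span_scale)
      then show "x \<in> complex_vector.span (e ` J)"
        using \<open>t > 0\<close> by (simp add: scaleC_scaleC scaleC_one)
    qed
    moreover have "complex_vector.span (e ` J) \<subseteq> E"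
    proof (rule complex_vector.span_minimal[OF _ subE], rule image_subsetI)
      fix i assume "i \<in> J"
      have "?D (e i) = (\<Sum>j\<in>J. complex_of_real ((s j)\<^sup>2) *\<^sub>C (cinner (e i) (e j) *\<^sub>C e j))"
        using orthonormal_familyD[OF e] \<open>i \<in> J\<close> by (intro single) auto
      also have "\<dots> = (\<Sum>j\<in>J. if j = i then complex_of_real (t\<^sup>2) *\<^sub>C e i else 0)"
        using orthonormal_familyD[OF e] eJ
        by (intro sum.cong) (auto simp: J_def scaleC_one scaleC.zero_left scaleC.zero_right)
      also have "\<dots> = complex_of_real (t\<^sup>2) *\<^sub>C e i" using \<open>finite J\<close> \<open>i \<in> J\<close> by simp
      finally show "e i \<in> E" by (simp add: E_def)
    qed
    ultimately have "E = complex_vector.span (e ` J)" by blast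
    moreover have "complex_vector.independent (e ` J)"
      unfolding complex_vector.dependent_def
    proof (clarify)
      fix i assume "i \<in> J" "e i \<in> complex_vector.span (e ` J - {e i})"
      have "cinner y (e i) = 0" if "y \<in> complex_vector.span (e ` J - {e i})" for y
        using that
      proof (induction rule: complex_vector.span_induct)
        case base
        show ?case
          by (rule complex_vector.subspaceI) (simp_all add: cinner_simps cinner.zero_left)
      next
        case (step x)
        then show ?case using orthonormal_familyD[OF e] by auto
      qed
      then have "cinner (e i) (e i) = 0" using \<open>e i \<in> complex_vector.span (e ` J - {e i})\<close> .
      then show False using eJ[OF \<open>i \<in> J\<close>] by (simp add: cinner_eq_zero_iff)
    qed
    ultimately have "complex_vector.dim E = card (e ` J)"
      by (simp add: complex_vector.dim_eq_card_independent)
    then show ?thesis using card_image[OF inj] by (simp add: E_def J_def KK)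
  qed
  show ?thesis
    unfolding singular_value_def
    using anti null dim by (intro the_equality null_sequence_eqI) auto
qed

section \<open>Symmetric norming functions\<close>

definition truncate :: "nat \<Rightarrow> (nat \<Rightarrow> real) \<Rightarrow> nat \<Rightarrow> real" where
  "truncate n \<xi> = (\<lambda>j. if j < n then \<xi> j else 0)"

lemma truncate_in_c00: "truncate n \<xi> \<in> c00"
  unfolding c00_def truncate_def by (auto intro: finite_subset[of _ "{..<n}"])

lemma restrict_in_c00: "\<xi> \<in> c00 \<Longrightarrow> (\<lambda>j. if P j then \<xi> j else 0) \<in> c00"
  unfolding c00_def by (auto elim!: rev_finite_subset)

locale symmetric_norming =
  fixes \<Phi> :: "(nat \<Rightarrow> real) \<Rightarrow> real"
  assumes sn: "sn_function \<Phi>"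
begin

lemma nonneg: "\<xi> \<in> c00 \<Longrightarrow> 0 \<le> \<Phi> \<xi>"
  and eq_0_iff: "\<xi> \<in> c00 \<Longrightarrow> \<Phi> \<xi> = 0 \<longleftrightarrow> \<xi> = (\<lambda>_. 0)"
  and scale: "\<xi> \<in> c00 \<Longrightarrow> \<Phi> (\<lambda>j. c * \<xi> j) = \<bar>c\<bar> * \<Phi> \<xi>"
  and triangle: "\<xi> \<in> c00 \<Longrightarrow> \<eta> \<in> c00 \<Longrightarrow> \<Phi> (\<lambda>j. \<xi> j + \<eta> j) \<le> \<Phi> \<xi> + \<Phi> \<eta>"
  and unit: "\<Phi> (\<lambda>j. if j = 0 then 1 else 0) = 1"
  and permute: "\<xi> \<in> c00 \<Longrightarrow> bij \<pi> \<Longrightarrow> \<Phi> (\<lambda>j. \<xi> (\<pi> j)) = \<Phi> \<xi>"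
  and abs: "\<xi> \<in> c00 \<Longrightarrow> \<Phi> (\<lambda>j. \<bar>\<xi> j\<bar>) = \<Phi> \<xi>"
  using sn unfolding sn_function_def by blast+

lemma eqI_abs:
  assumes "\<xi> \<in> c00" "\<eta> \<in> c00" "\<And>j. \<bar>\<xi> j\<bar> = \<bar>\<eta> j\<bar>"
  shows "\<Phi> \<xi> = \<Phi> \<eta>"
  using abs[OF assms(1)] abs[OF assms(2)] assms(3) by simp

text \<open>Deleting a coordinate averages the sequence with the one where that coordinate changes sign.\<close>

lemma delete_coordinate_le:
  assumes "\<xi> \<in> c00"
  shows "\<Phi> (\<xi>(k := 0)) \<le> \<Phi> \<xi>"
proof -
  have up: "\<xi>(k := c) \<in> c00" for c
    using assms unfolding c00_def by (auto elim!: rev_finite_subset[of "insert k _", OF finite_insert[THEN iffD2]])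
  have half: "(\<lambda>j. 1/2 * \<eta> j) \<in> c00" if "\<eta> \<in> c00" for \<eta>
    using that by (simp add: c00_def)
  have "\<xi>(k := 0) = (\<lambda>j. 1/2 * \<xi> j + 1/2 * (\<xi>(k := - \<xi> k)) j)" by (auto simp: fun_eq_iff)
  then have "\<Phi> (\<xi>(k := 0)) \<le> \<Phi> (\<lambda>j. 1/2 * \<xi> j) + \<Phi> (\<lambda>j. 1/2 * (\<xi>(k := - \<xi> k)) j)"
    using triangle[OF half[OF assms] half[OF up]] by simp
  also have "\<dots> = 1/2 * \<Phi> \<xi> + 1/2 * \<Phi> (\<xi>(k := - \<xi> k))"
    unfolding scale[OF assms] scale[OF up] by simp
  also have "\<Phi> (\<xi>(k := - \<xi> k)) = \<Phi> \<xi>" by (rule eqI_abs[OF up assms]) simp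
  finally show ?thesis by linarith
qed

text \<open>Only finitely many nonzero coordinates violate \<open>P\<close>, and they are deleted
  one at a time. This makes truncations increase in norm and later allows cutting the maximiser to
  the support of \<open>a\<close>.\<close>

lemma restrict_le:
  assumes \<xi>: "\<xi> \<in> c00"
  shows "\<Phi> (\<lambda>j. if P j then \<xi> j else 0) \<le> \<Phi> \<xi>"
proof -
  have "\<Phi> (\<lambda>j. if j \<in> F then 0 else \<xi> j) \<le> \<Phi> \<xi>" if "finite F" for F
    using that
  proof induction
    case (insert k F)
    have "(\<lambda>j. if j \<in> F then 0 else \<xi> j) = (\<lambda>j. if j \<notin> F then \<xi> j else 0)" by auto
    then have "(\<lambda>j. if j \<in> F then 0 else \<xi> j) \<in> c00"
      using restrict_in_c00[OF \<xi>, of "\<lambda>j. j \<notin> F"] by (simp only:)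
    from delete_coordinate_le[OF this, of k]
    have "\<Phi> ((\<lambda>j. if j \<in> F then 0 else \<xi> j)(k := 0)) \<le> \<Phi> \<xi>" using insert.IH by simp
    moreover have "(\<lambda>j. if j \<in> F then 0 else \<xi> j)(k := 0) = (\<lambda>j. if j \<in> insert k F then 0 else \<xi> j)"
      by auto
    ultimately show ?case by simp
  qed simp
  from this[of "{j. \<xi> j \<noteq> 0 \<and> \<not> P j}"]
  have "\<Phi> (\<lambda>j. if j \<in> {j. \<xi> j \<noteq> 0 \<and> \<not> P j} then 0 else \<xi> j) \<le> \<Phi> \<xi>"
    using \<xi> by (simp add: c00_def)
  also have "(\<lambda>j. if j \<in> {j. \<xi> j \<noteq> 0 \<and> \<not> P j} then 0 else \<xi> j) = (\<lambda>j. if P j then \<xi> j else 0)"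
    by auto
  finally show ?thesis .
qed

lemma truncate_mono:
  assumes "m \<le> n"
  shows "\<Phi> (truncate m \<xi>) \<le> \<Phi> (truncate n \<xi>)"
proof -
  have "truncate m \<xi> = (\<lambda>j. if j < m then truncate n \<xi> j else 0)"
    using assms by (auto simp: truncate_def)
  then show ?thesis using restrict_le[OF truncate_in_c00, of "\<lambda>j. j < m" n \<xi>] by simp
qed

text \<open>A transposition moves the first unit sequence to any coordinate, so all of them have
  norm 1; the triangle inequality does the rest. It is the domination of \<Phi> by the maximal
  norming function.\<close>

lemma truncate_le_sum: "\<Phi> (truncate n \<xi>) \<le> (\<Sum>j<n. \<bar>\<xi> j\<bar>)"
proof (induction n)
  case 0
  show ?case using eq_0_iff[OF truncate_in_c00[of 0 \<xi>]] by (simp add: truncate_def)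
next
  case (Suc n)
  let ?\<delta> = "\<lambda>k j :: nat. if j = k then 1 else 0 :: real"
  have \<delta>: "?\<delta> k \<in> c00" for k by (simp add: c00_def)
  have "\<Phi> (?\<delta> n) = \<Phi> (\<lambda>j. ?\<delta> 0 (Transposition.transpose 0 n j))"
    by (rule arg_cong[of _ _ \<Phi>]) (auto simp: fun_eq_iff Transposition.transpose_def)
  also have "\<dots> = 1" by (simp only: permute[OF \<delta> bij_transpose] unit)
  finally have 1: "\<Phi> (?\<delta> n) = 1" .
  have "truncate (Suc n) \<xi> = (\<lambda>j. truncate n \<xi> j + \<xi> n * ?\<delta> n j)"
    by (auto simp: truncate_def fun_eq_iff less_Suc_eq)
  moreover have "(\<lambda>j. \<xi> n * ?\<delta> n j) \<in> c00" by (simp add: c00_def)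
  ultimately have "\<Phi> (truncate (Suc n) \<xi>) \<le> \<Phi> (truncate n \<xi>) + \<Phi> (\<lambda>j. \<xi> n * ?\<delta> n j)"
    using triangle[OF truncate_in_c00] by simp
  also have "\<Phi> (\<lambda>j. \<xi> n * ?\<delta> n j) = \<bar>\<xi> n\<bar>" unfolding scale[OF \<delta>] 1 by simp
  finally show ?case using Suc.IH by simp
qed

lemma truncate_diff_le:
  "\<bar>\<Phi> (truncate n \<xi>) - \<Phi> (truncate n \<eta>)\<bar> \<le> (\<Sum>j<n. \<bar>\<xi> j - \<eta> j\<bar>)"
proof -
  have "\<Phi> (truncate n \<xi>) - \<Phi> (truncate n \<eta>) \<le> (\<Sum>j<n. \<bar>\<xi> j - \<eta> j\<bar>)" for \<xi> \<eta>
  proof -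
    have "truncate n \<xi> = (\<lambda>j. truncate n (\<lambda>j. \<xi> j - \<eta> j) j + truncate n \<eta> j)"
      by (auto simp: truncate_def)
    then have "\<Phi> (truncate n \<xi>) \<le> \<Phi> (truncate n (\<lambda>j. \<xi> j - \<eta> j)) + \<Phi> (truncate n \<eta>)"
      using triangle[OF truncate_in_c00 truncate_in_c00] by metis
    then show ?thesis using truncate_le_sum[of n "\<lambda>j. \<xi> j - \<eta> j"] by linarith
  qed
  from this[of \<xi> \<eta>] this[of \<eta> \<xi>] show ?thesis by (simp add: abs_minus_commute abs_le_iff)
qed

text \<open>A truncation sees only \<open>n\<close> coordinates and \<Phi> is Lipschitz in their
  absolute sum, which suffices for the product topology.\<close>

lemma continuous_on_truncate: "continuous_on UNIV (\<lambda>\<xi>. \<Phi> (truncate n \<xi>))"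
  unfolding continuous_on_def
proof (intro ballI)
  fix \<eta> :: "nat \<Rightarrow> real"
  have coord: "((\<lambda>\<xi>. \<xi> j) \<longlongrightarrow> \<eta> j) (at \<eta>)" for j
    using continuous_on_product_coordinates[of j] unfolding continuous_on_def by auto
  have "((\<lambda>\<xi>. \<Sum>j<n. \<bar>\<xi> j - \<eta> j\<bar>) \<longlongrightarrow> (\<Sum>j<n. \<bar>\<eta> j - \<eta> j\<bar>)) (at \<eta>)"
    by (intro tendsto_intros coord)
  then have null: "((\<lambda>\<xi>. \<Sum>j<n. \<bar>\<xi> j - \<eta> j\<bar>) \<longlongrightarrow> 0) (at \<eta>)"
    by (simp only: diff_self abs_zero sum.neutral_const)
  have "((\<lambda>\<xi>. \<Phi> (truncate n \<xi>) - \<Phi> (truncate n \<eta>)) \<longlongrightarrow> 0) (at \<eta>)"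
  proof (rule Lim_null_comparison[OF always_eventually null])
    show "\<forall>\<xi>. norm (\<Phi> (truncate n \<xi>) - \<Phi> (truncate n \<eta>)) \<le> (\<Sum>j<n. \<bar>\<xi> j - \<eta> j\<bar>)"
      by (simp only: real_norm_def truncate_diff_le simp_thms)
  qed
  then show "((\<lambda>\<xi>. \<Phi> (truncate n \<xi>)) \<longlongrightarrow> \<Phi> (truncate n \<eta>)) (at \<eta>)"
    by (rule Lim_null[THEN iffD2])
qed

text \<open>The values increase and stay below the sum of the series, so the \<open>lim\<close> in
  \<open>sn_norm\<close> is a genuine limit, and an upper bound for all truncations.\<close>

lemma truncate_limit:
  assumes "summable \<xi>" "\<And>j. 0 \<le> \<xi> j"
  shows "(\<lambda>n. \<Phi> (truncate n \<xi>)) \<longlonglongrightarrow> lim (\<lambda>n. \<Phi> (truncate n \<xi>))"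
    and "\<Phi> (truncate n \<xi>) \<le> lim (\<lambda>n. \<Phi> (truncate n \<xi>))"
proof -
  have inc: "incseq (\<lambda>n. \<Phi> (truncate n \<xi>))" by (rule incseq_SucI) (simp add: truncate_mono)
  have "\<Phi> (truncate n \<xi>) \<le> suminf \<xi>" for n
    using truncate_le_sum[of n \<xi>] sum_le_suminf[OF assms(1), of "{..<n}"] assms(2) by simp
  then have "convergent (\<lambda>n. \<Phi> (truncate n \<xi>))"
    using incseq_convergent[OF inc, of "suminf \<xi>"] unfolding convergent_def by blast
  then show lim: "(\<lambda>n. \<Phi> (truncate n \<xi>)) \<longlonglongrightarrow> lim (\<lambda>n. \<Phi> (truncate n \<xi>))"
    by (simp add: convergent_LIMSEQ_iff)
  show "\<Phi> (truncate n \<xi>) \<le> lim (\<lambda>n. \<Phi> (truncate n \<xi>))" by (rule incseq_le[OF inc lim])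
qed

text \<open>Bounding every truncation extends the unit ball of \<Phi> beyond \<open>c00\<close>, by
  conditions each closed for coordinatewise convergence.\<close>

definition decreasing_ball :: "(nat \<Rightarrow> real) set" where
  "decreasing_ball = {\<xi>. (\<forall>j. 0 \<le> \<xi> j) \<and> antimono \<xi> \<and> (\<forall>n. \<Phi> (truncate n \<xi>) \<le> 1)}"

lemma decreasing_ballD:
  assumes "\<xi> \<in> decreasing_ball"
  shows "0 \<le> \<xi> j" "antimono \<xi>" "\<Phi> (truncate n \<xi>) \<le> 1"
  using assms by (auto simp: decreasing_ball_def)

end

section \<open>Compactness under equivalence with the maximal norming function\<close>

locale symmetric_norming_max = symmetric_norming +
  assumes equiv: "sn_equivalent \<Phi> sn_max"
begin

lemma sum_bound: "\<exists>C. \<forall>\<xi>\<in>decreasing_ball. \<forall>n. (\<Sum>j<n. \<xi> j) \<le> C"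
proof -
  obtain C where C: "\<And>\<xi>. \<xi> \<in> c00 \<Longrightarrow> \<xi> \<noteq> (\<lambda>_. 0) \<Longrightarrow> sn_max \<xi> / \<Phi> \<xi> \<le> C"
    using equiv unfolding sn_equivalent_def bdd_above_def by auto
  \<comment> \<open>\<open>C\<close> bounds ratios of nonzero sequences only; the maximum with 0
    covers the zero truncation and gives a nonnegative factor.\<close>
  have "(\<Sum>j<n. \<xi> j) \<le> max C 0" if \<xi>: "\<xi> \<in> decreasing_ball" for \<xi> n
  proof -
    let ?\<tau> = "truncate n \<xi>"
    have "sn_max ?\<tau> = (\<Sum>j<n. \<bar>?\<tau> j\<bar>)"
      unfolding sn_max_def by (rule sum.mono_neutral_left) (auto simp: truncate_def)
    then have s: "sn_max ?\<tau> = (\<Sum>j<n. \<xi> j)" using decreasing_ballD(1)[OF \<xi>] by (simp add: truncate_def)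
    show ?thesis
    proof (cases "?\<tau> = (\<lambda>_. 0)")
      case True
      then show ?thesis using s by (simp add: sn_max_def)
    next
      case False
      then have pos: "\<Phi> ?\<tau> > 0"
        using nonneg[OF truncate_in_c00] eq_0_iff[OF truncate_in_c00] by (metis less_eq_real_def)
      then have "sn_max ?\<tau> \<le> C * \<Phi> ?\<tau>" using C[OF truncate_in_c00 False] by (simp add: pos_divide_le_eq)
      also have "\<dots> \<le> max C 0 * \<Phi> ?\<tau>" using pos by (intro mult_right_mono) auto
      also have "\<dots> \<le> max C 0 * 1" using decreasing_ballD(3)[OF \<xi>] by (intro mult_left_mono) auto
      finally show ?thesis using s by simp
    qed
  qed
  then show ?thesis by blast
qed

lemma summable_decreasing_ball:
  assumes "\<xi> \<in> decreasing_ball"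
  shows "summable \<xi>"
proof -
  obtain C where "\<And>n. (\<Sum>j<n. \<xi> j) \<le> C" using sum_bound assms by blast
  then show ?thesis by (intro summableI_nonneg_bounded[of _ C] decreasing_ballD(1)[OF assms])
qed

text \<open>A closed subset of a product of intervals, which is compact by Tychonoff's theorem.
  Monotonicity is restated for successors, so that each condition compares two coordinates.\<close>

lemma compact_decreasing_ball: "compact decreasing_ball"
proof -
  obtain C where C: "\<And>\<xi> n. \<xi> \<in> decreasing_ball \<Longrightarrow> (\<Sum>j<n. \<xi> j) \<le> C" using sum_bound by blast
  have "\<xi> j \<in> {0..C}" if \<xi>: "\<xi> \<in> decreasing_ball" for \<xi> j
  proof -
    have "\<xi> j \<le> (\<Sum>i<Suc j. \<xi> i)"
      using decreasing_ballD(1)[OF \<xi>] by (simp add: sum_nonneg)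
    then show ?thesis using C[OF \<xi>, of "Suc j"] decreasing_ballD(1)[OF \<xi>] by simp
  qed
  then have sub: "decreasing_ball \<subseteq> (\<Pi>\<^sub>E j\<in>UNIV. {0..C})" by (auto simp: PiE_def)
  have "compactin (product_topology (\<lambda>_. euclidean) UNIV) (\<Pi>\<^sub>E j\<in>(UNIV::nat set). {0..C})"
    unfolding compactin_PiE by (simp add: compactin_euclidean_iff)
  then have comp: "compact (\<Pi>\<^sub>E j\<in>(UNIV::nat set). {0..C})"
    by (simp add: euclidean_product_topology compactin_euclidean_iff)
  have "decreasing_ball = {\<xi>. \<forall>j. 0 \<le> \<xi> j} \<inter> {\<xi>. \<forall>j. \<xi> (Suc j) \<le> \<xi> j} \<inter> {\<xi>. \<forall>n. \<Phi> (truncate n \<xi>) \<le> 1}"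
    unfolding decreasing_ball_def antimono_iff_le_Suc by blast
  also have "closed \<dots>"
    by (intro closed_Int closed_Collect_all closed_Collect_le continuous_on_const
        continuous_on_product_coordinates continuous_on_truncate)
  finally show ?thesis using comp sub compact_Int_closed by (metis Int_absorb1)
qed

lemma summable_pairing:
  assumes "\<xi> \<in> decreasing_ball" "antimono a" "a \<longlonglongrightarrow> 0"
  shows "summable (\<lambda>j. a j * \<xi> j)"
  using antimono_null_nonneg[OF assms(2,3)] antimonoD[OF assms(2)] decreasing_ballD(1)[OF assms(1)]
  by (intro summable_comparison_test'[OF summable_mult[OF summable_decreasing_ball[OF assms(1)], of "a 0"], of 0])
    (auto simp: abs_mult intro!: mult_right_mono)

text \<open>The finite partial sums are continuous and converge uniformly on the ball, since the
  tail from \<open>n\<close> on is at most \<open>a n\<close> times the common bound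
  \<open>C\<close> of the sums.\<close>

lemma pairing_attains_max:
  assumes a: "antimono a" "a \<longlonglongrightarrow> 0"
  shows "\<exists>\<xi>\<in>decreasing_ball. \<forall>\<eta>\<in>decreasing_ball. (\<Sum>j. a j * \<eta> j) \<le> (\<Sum>j. a j * \<xi> j)"
proof (rule continuous_attains_sup[OF compact_decreasing_ball])
  have "\<Phi> (truncate n (\<lambda>_. 0)) = 0" for n
    using eq_0_iff[OF truncate_in_c00[of n "\<lambda>_. 0"]] by (simp add: truncate_def)
  then have "(\<lambda>_. 0) \<in> decreasing_ball" by (simp add: decreasing_ball_def antimono_def)
  then show "decreasing_ball \<noteq> {}" by blast
  obtain C where C: "\<And>\<xi> n. \<xi> \<in> decreasing_ball \<Longrightarrow> (\<Sum>j<n. \<xi> j) \<le> C" using sum_bound by blast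
  note nn = antimono_null_nonneg[OF a]
  have tail: "\<bar>(\<Sum>j<n. a j * \<xi> j) - (\<Sum>j. a j * \<xi> j)\<bar> \<le> a n * C" if \<xi>: "\<xi> \<in> decreasing_ball" for \<xi> n
  proof -
    note S = summable_pairing[OF \<xi> a] and S' = summable_decreasing_ball[OF \<xi>]
    note nn' = decreasing_ballD(1)[OF \<xi>]
    have eq: "(\<Sum>j. a j * \<xi> j) - (\<Sum>j<n. a j * \<xi> j) = (\<Sum>j. a (j + n) * \<xi> (j + n))"
      by (rule suminf_minus_initial_segment[OF S, symmetric])
    have "(\<Sum>j. a (j + n) * \<xi> (j + n)) \<le> (\<Sum>j. a n * \<xi> (j + n))"
      using antimonoD[OF a(1)] nn'
      by (intro suminf_le mult_right_mono summable_ignore_initial_segment[OF S]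
          summable_mult summable_ignore_initial_segment[OF S']) auto
    also have "\<dots> = a n * (suminf \<xi> - (\<Sum>j<n. \<xi> j))"
      using suminf_mult[OF summable_ignore_initial_segment[OF S', of n], of "a n"]
        suminf_minus_initial_segment[OF S', of n] by (simp only:)
    also have "\<dots> \<le> a n * C"
    proof (rule mult_left_mono[OF _ nn])
      have "suminf \<xi> \<le> C" using C[OF \<xi>] by (intro suminf_le_const[OF S'])
      then show "suminf \<xi> - (\<Sum>j<n. \<xi> j) \<le> C" using sum_nonneg[of "{..<n}" \<xi>] nn' by simp
    qed
    moreover have "0 \<le> (\<Sum>j. a (j + n) * \<xi> (j + n))"
      using nn nn' by (intro suminf_nonneg summable_ignore_initial_segment[OF S]) auto
    ultimately show ?thesis using eq by linarith
  qed
  show "continuous_on decreasing_ball (\<lambda>\<xi>. \<Sum>j. a j * \<xi> j)"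
  proof (rule uniform_limit_theorem)
    show "\<forall>\<^sub>F n in sequentially. continuous_on decreasing_ball (\<lambda>\<xi>. \<Sum>j<n. a j * \<xi> j)"
      by (intro always_eventually allI continuous_intros
          continuous_on_subset[OF continuous_on_product_coordinates]) auto
    show "uniform_limit decreasing_ball (\<lambda>n \<xi>. \<Sum>j<n. a j * \<xi> j) (\<lambda>\<xi>. \<Sum>j. a j * \<xi> j) sequentially"
    proof (rule uniform_limitI)
      fix \<epsilon> :: real assume "\<epsilon> > 0"
      have "(\<lambda>n. a n * C) \<longlonglongrightarrow> 0" by (rule tendsto_mult_left_zero[OF a(2)])
      then have "\<forall>\<^sub>F n in sequentially. a n * C < \<epsilon>" using \<open>\<epsilon> > 0\<close> by (rule order_tendstoD)
      then show "\<forall>\<^sub>F n in sequentially. \<forall>\<xi>\<in>decreasing_ball. dist (\<Sum>j<n. a j * \<xi> j) (\<Sum>j. a j * \<xi> j) < \<epsilon>"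
        by eventually_elim (use tail le_less_trans in \<open>fastforce simp: dist_real_def\<close>)
    qed
  qed simp
qed

end

lemma Abel_sum_mono:
  fixes s :: "nat \<Rightarrow> real"
  assumes s: "antimono s" "\<And>j. 0 \<le> s j"
    and le: "\<And>n. (\<Sum>j<n. b j) \<le> (\<Sum>j<n. a j)"
  shows "(\<Sum>j<n. s j * b j) \<le> (\<Sum>j<n. s j * a j)"
proof -
  \<comment> \<open>Strengthened for the induction: the surplus of the partial sums, weighted by the
    current \<open>s n\<close>, stays in reserve, and lowering the weight to
    \<open>s (Suc n)\<close> only weakens the bound.\<close>
  have "s n * ((\<Sum>j<n. a j) - (\<Sum>j<n. b j)) \<le> (\<Sum>j<n. s j * a j) - (\<Sum>j<n. s j * b j)" for n
  proof (induction n)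
    case (Suc n)
    have "s (Suc n) * ((\<Sum>j<Suc n. a j) - (\<Sum>j<Suc n. b j)) \<le> s n * ((\<Sum>j<Suc n. a j) - (\<Sum>j<Suc n. b j))"
      using antimonoD[OF s(1), of n "Suc n"] le[of "Suc n"] by (intro mult_right_mono) auto
    also have "\<dots> = s n * ((\<Sum>j<n. a j) - (\<Sum>j<n. b j)) + (s n * a n - s n * b n)"
      by (simp add: algebra_simps)
    finally show ?case using Suc.IH by simp
  qed simp
  moreover have "0 \<le> s n * ((\<Sum>j<n. a j) - (\<Sum>j<n. b j))" using s(2) le by simp
  ultimately show ?thesis by (smt (verit))
qed

section \<open>The trace inequality and the extremal operator\<close>

lemma norm_le_first_singular_value:
  fixes A :: "'a::chilbert_space \<Rightarrow> 'a"
  assumes "singular_decomposition A a u v"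
  shows "norm (A x) \<le> a 0 * norm x"
  using diagonal.norm_tail_le[OF singular_decompositionD(1)[OF assms], of x 0]
    singular_decompositionD(2)[OF assms] by simp

text \<open>Expanding \<open>A\<close> bounds the left side by sums of \<open>a k * c k\<close>,
  where the weights \<open>c k\<close> collect moduli of coefficients. Each weight is at most 1 and
  their total at most \<open>n\<close>, and for decreasing \<open>a\<close> such weights give most
  when they sit on the first \<open>n\<close> indices.\<close>

lemma Ky_Fan_inequality:
  fixes A :: "'a::chilbert_space \<Rightarrow> 'a"
  assumes A: "singular_decomposition A a u v"
    and e: "orthonormal_family e" and f: "orthonormal_family f"
  shows "(\<Sum>j<n. cmod (cinner (A (f j)) (e j))) \<le> (\<Sum>k<n. a k)"
proof (rule LIMSEQ_le_const2)
  note D = singular_decompositionD[OF A]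
  note a_nn = antimono_null_nonneg[OF D(6,7)]
  define c where "c k = (\<Sum>j<n. cmod (cinner (u k) (f j)) * cmod (cinner (v k) (e j)))" for k
  have c_le_1: "c k \<le> 1" for k
  proof -
    have "c k \<le> norm (u k) * norm (v k)" unfolding c_def by (rule Bessel_bilinear[OF f e])
    also have "\<dots> \<le> 1 * 1"
      by (intro mult_mono norm_orthonormal_family_le D) auto
    finally show ?thesis by simp
  qed
  \<comment> \<open>Bessel's inequality for each \<open>j\<close> bounds the total by n, and
    \<open>c k \<le> 1\<close> bounds it by N; the smaller of the two is the partial sum of the
    indicator of the first n indices, as Abel summation wants it.\<close>
  have sum_c: "(\<Sum>k<N. c k) \<le> (\<Sum>k<N. of_bool (k < n))" for N
  proof -
    have "(\<Sum>k<N. c k) = (\<Sum>j<n. \<Sum>k<N. cmod (cinner (f j) (u k)) * cmod (cinner (e j) (v k)))"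
      unfolding c_def by (subst sum.swap) (simp add: cmod_cinner_commute[of "u _"] cmod_cinner_commute[of "v _"])
    also have "\<dots> \<le> (\<Sum>j<n. 1)"
    proof (rule sum_mono)
      fix j
      have "(\<Sum>k<N. cmod (cinner (f j) (u k)) * cmod (cinner (e j) (v k))) \<le> norm (f j) * norm (e j)"
        by (intro Bessel_bilinear D)
      also have "\<dots> \<le> 1 * 1" by (intro mult_mono norm_orthonormal_family_le e f) auto
      finally show "(\<Sum>k<N. cmod (cinner (f j) (u k)) * cmod (cinner (e j) (v k))) \<le> 1" by simp
    qed
    finally have "(\<Sum>k<N. c k) \<le> real n" by simp
    moreover have "(\<Sum>k<N. c k) \<le> real N" using sum_mono[of "{..<N}" c "\<lambda>_. 1"] c_le_1 by simp
    moreover have "{..<N} \<inter> {k. k < n} = {..<min N n}" by auto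
    ultimately show ?thesis by (simp add: of_bool_def sum.If_cases)
  qed
  show "(\<lambda>N. \<Sum>j<n. cmod (cinner (\<Sum>k<N. a k *\<^sub>R (cinner (f j) (u k) *\<^sub>C v k)) (e j)))
      \<longlonglongrightarrow> (\<Sum>j<n. cmod (cinner (A (f j)) (e j)))"
    using D(5) unfolding sums_def
    by (intro tendsto_sum tendsto_norm bounded_linear.tendsto[OF cinner.bounded_linear_left]) auto
  have "(\<Sum>j<n. cmod (cinner (\<Sum>k<N. a k *\<^sub>R (cinner (f j) (u k) *\<^sub>C v k)) (e j))) \<le> (\<Sum>k<n. a k)" for N
  proof -
    have "(\<Sum>j<n. cmod (cinner (\<Sum>k<N. a k *\<^sub>R (cinner (f j) (u k) *\<^sub>C v k)) (e j)))
        \<le> (\<Sum>j<n. \<Sum>k<N. a k * (cmod (cinner (u k) (f j)) * cmod (cinner (v k) (e j))))"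
      unfolding cinner.sum_left
      by (intro sum_mono sum_norm_le)
        (simp add: cinner_simps norm_mult a_nn cmod_cinner_commute[of "u _"])
    also have "\<dots> = (\<Sum>k<N. a k * c k)"
      unfolding c_def sum_distrib_left by (rule sum.swap)
    also have "\<dots> \<le> (\<Sum>k<N. a k * of_bool (k < n))"
      by (rule Abel_sum_mono[OF D(6) a_nn sum_c])
    also have "\<dots> = (\<Sum>k\<in>{..<N} \<inter> {..<n}. a k)"
      by (simp add: of_bool_def if_distrib sum.If_cases lessThan_def cong: if_cong)
    also have "\<dots> \<le> (\<Sum>k<n. a k)" by (rule sum_mono2) (auto simp: a_nn)
    finally show ?thesis .
  qed
  then show "\<exists>N. \<forall>m\<ge>N. (\<Sum>j<n. cmod (cinner (\<Sum>k<m. a k *\<^sub>R (cinner (f j) (u k) *\<^sub>C v k)) (e j)))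
      \<le> (\<Sum>k<n. a k)" by blast
qed

text \<open>Applying \<open>A\<close> termwise leaves a series with the same \<open>s\<close> and
  \<open>e\<close>, whose second vectors \<open>A (f j)\<close> are bounded but in general no longer
  orthonormal.\<close>

lemma ctrace_comp:
  assumes A: "singular_decomposition A a u v" "bounded_clinear A"
    and K: "singular_decomposition K s e f" and s: "summable s"
  shows "ctrace (A \<circ> K) = (\<Sum>j. s j *\<^sub>R cinner (A (f j)) (e j))"
proof (rule ctrace_diagonal[OF s])
  note D = singular_decompositionD[OF K]
  have bl: "bounded_linear A" using A(2) by (rule bounded_clinear_imp_bounded_linear)
  show "0 \<le> s j" for j by (rule antimono_null_nonneg[OF D(6,7)])
  show "norm (e j) \<le> 1" for j by (rule norm_orthonormal_family_le[OF D(8)])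
  show "norm (A (f j)) \<le> a 0" for j
  proof -
    have "norm (A (f j)) \<le> a 0 * norm (f j)" by (rule norm_le_first_singular_value[OF A(1)])
    also have "\<dots> \<le> a 0 * 1"
      using singular_decompositionD(6,7)[OF A(1)]
      by (intro mult_left_mono norm_orthonormal_family_le[OF D(9)] antimono_null_nonneg)
    finally show ?thesis by simp
  qed
  fix x
  have "(\<lambda>j. A (s j *\<^sub>R (cinner x (e j) *\<^sub>C f j))) sums A (K x)"
    by (rule bounded_linear.sums[OF bl D(5)])
  then show "(\<lambda>j. s j *\<^sub>R (cinner x (e j) *\<^sub>C A (f j))) sums (A \<circ> K) x"
    using bounded_linear.linear[OF bl] by (simp add: linear_cmul bounded_clinear_scaleC[OF A(2)])
qed

lemma bounded_clinear_if_compact: "compact_operator A \<Longrightarrow> bounded_clinear A"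
  by (simp add: compact_operator_def)

section \<open>Extremal operators for the dual norm\<close>

context symmetric_norming_max
begin

lemma sn_norm_eq: "sn_norm \<Phi> K = lim (\<lambda>n. \<Phi> (truncate n (singular_value K)))"
  unfolding sn_norm_def truncate_def ..

text \<open>The first conclusion places every competitor in the compact set, the second compares it
  with the maximiser there. The bound on finite partial sums also supplies absolute convergence of
  the trace series.\<close>

lemma ctrace_le_pairing:
  assumes A: "compact_operator A" "singular_decomposition A a u v"
    and K: "trace_class K" "sn_norm \<Phi> K \<le> 1"
  shows "singular_value K \<in> decreasing_ball"
    and "cmod (ctrace (A \<circ> K)) \<le> (\<Sum>j. a j * singular_value K j)"
proof -
  note DA = singular_decompositionD[OF A(2)]
  obtain s e f where sd: "singular_decomposition K s e f"
    using K(1) singular_decomposition_exists unfolding trace_class_def by blast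
  note D = singular_decompositionD[OF sd]
  have s: "singular_value K = s" by (rule singular_value_eq[OF sd])
  have sum: "summable s" using K(1) s by (simp add: trace_class_def)
  note s_nn = antimono_null_nonneg[OF D(6,7)]
  have ball: "s \<in> decreasing_ball"
    using truncate_limit(2)[OF sum s_nn] K(2) s_nn D(6)
    unfolding decreasing_ball_def sn_norm_eq s by (auto intro: order_trans)
  then show "singular_value K \<in> decreasing_ball" by (simp add: s)
  define b where "b j = cmod (cinner (A (f j)) (e j))" for j
  have partial: "(\<Sum>j<n. s j * b j) \<le> (\<Sum>j. a j * s j)" for n
  proof -
    have "(\<Sum>j<n. s j * b j) \<le> (\<Sum>j<n. s j * a j)"
      unfolding b_def by (rule Abel_sum_mono[OF D(6) s_nn Ky_Fan_inequality[OF A(2) D(8,9)]])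
    also have "\<dots> = (\<Sum>j<n. a j * s j)" by (simp add: mult.commute)
    also have "\<dots> \<le> (\<Sum>j. a j * s j)"
      using antimono_null_nonneg[OF DA(6,7)] s_nn
      by (intro sum_le_suminf summable_pairing[OF ball DA(6,7)]) auto
    finally show ?thesis .
  qed
  have sum_sb: "summable (\<lambda>j. s j * b j)"
    using partial s_nn by (intro summableI_nonneg_bounded) (auto simp: b_def)
  have norm_eq: "cmod (s j *\<^sub>R cinner (A (f j)) (e j)) = s j * b j" for j
    by (simp add: b_def s_nn)
  have "ctrace (A \<circ> K) = (\<Sum>j. s j *\<^sub>R cinner (A (f j)) (e j))"
    by (rule ctrace_comp[OF A(2) bounded_clinear_if_compact[OF A(1)] sd sum])
  also have "cmod \<dots> \<le> (\<Sum>j. s j * b j)"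
    using summable_norm[of "\<lambda>j. s j *\<^sub>R cinner (A (f j)) (e j)"] sum_sb by (simp only: norm_eq)
  also have "\<dots> \<le> (\<Sum>j. a j * s j)" by (rule suminf_le_const[OF sum_sb partial])
  finally show "cmod (ctrace (A \<circ> K)) \<le> (\<Sum>j. a j * singular_value K j)" by (simp add: s)
qed

lemma dual_norming_if_extremal:
  assumes A: "compact_operator A" "singular_decomposition A a u v"
    and K: "trace_class K" "sn_norm \<Phi> K = 1"
    and max: "\<And>\<eta>. \<eta> \<in> decreasing_ball \<Longrightarrow> (\<Sum>j. a j * \<eta> j) \<le> cmod (ctrace (A \<circ> K))"
  shows "dual_norming \<Phi> A"
proof -
  have "sn_dual_norm \<Phi> A = cmod (ctrace (A \<circ> K))"
    unfolding sn_dual_norm_def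
  proof (rule cSup_eq_maximum)
    show "cmod (ctrace (A \<circ> K)) \<in> {cmod (ctrace (A \<circ> K)) |K. trace_class K \<and> sn_norm \<Phi> K \<le> 1}"
      using K by auto
    fix x assume "x \<in> {cmod (ctrace (A \<circ> K)) |K. trace_class K \<and> sn_norm \<Phi> K \<le> 1}"
    then show "x \<le> cmod (ctrace (A \<circ> K))"
      using ctrace_le_pairing[OF A] max order_trans by blast
  qed
  then show ?thesis using K unfolding dual_norming_def by metis
qed

lemma dual_norming_zero:
  fixes A :: "'a::chilbert_space \<Rightarrow> 'a" and h :: 'a
  assumes A: "compact_operator A" "singular_decomposition A a u v" and "a 0 = 0" and h: "h \<noteq> 0"
  shows "dual_norming \<Phi> A"
proof -
  define s :: "nat \<Rightarrow> real" where "s j = (if j = 0 then 1 else 0)" for j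
  define e where "e j = (if j = 0 then (1 / norm h) *\<^sub>R h else 0)" for j :: nat
  have e: "orthonormal_family e"
    using h by (auto simp: orthonormal_family_def e_def cinner_simps cinner_self cinner.zero_left
        cinner.zero_right power2_eq_square scaleR_conv_of_real)
  have sum: "summable s" by (rule summable_finite[of "{0}"]) (simp_all add: s_def)
  have diag: "diagonal s e e"
    using e summable_LIMSEQ_zero[OF sum] by unfold_locales (auto simp: s_def antimono_def)
  let ?K = "diagonal_operator s e e"
  have sd: "singular_decomposition ?K s e e"
    using h by (intro singular_decomposition_diagonal_operator[OF diag]) (auto simp: e_def s_def)
  note s = singular_value_eq[OF sd]
  have K: "trace_class ?K"
    using diagonal.compact_operator_operator[OF diag] sum s by (simp add: trace_class_def)
  \<comment> \<open>The shift by one avoids \<open>truncate 0 s\<close>, which is the zero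
    sequence.\<close>
  have "\<Phi> (truncate (Suc n) s) = 1" for n
  proof -
    have "truncate (Suc n) s = (\<lambda>j. if j = 0 then 1 else 0)" by (auto simp: truncate_def s_def)
    then show ?thesis using unit by simp
  qed
  then have "(\<lambda>n. \<Phi> (truncate (Suc n) s)) \<longlonglongrightarrow> 1" by simp
  then have "sn_norm \<Phi> ?K = 1" unfolding sn_norm_eq s by (intro limI) (rule LIMSEQ_imp_Suc)
  moreover have "(\<Sum>j. a j * \<eta> j) = 0" for \<eta>
  proof -
    have "a j = 0" for j
      using antimonoD[OF singular_decompositionD(6)[OF A(2)], of 0 j] \<open>a 0 = 0\<close>
        antimono_null_nonneg[OF singular_decompositionD(6,7)[OF A(2)], of j] by simp
    then show ?thesis by simp
  qed
  ultimately show ?thesis by (intro dual_norming_if_extremal[OF A K]) auto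
qed

lemma dual_norming_nonzero:
  fixes A :: "'a::chilbert_space \<Rightarrow> 'a"
  assumes A: "compact_operator A" "singular_decomposition A a u v" and a0: "a 0 \<noteq> 0"
  shows "dual_norming \<Phi> A"
proof -
  note D = singular_decompositionD[OF A(2)]
  note a_nn = antimono_null_nonneg[OF D(6,7)]
  obtain \<xi> where \<xi>: "\<xi> \<in> decreasing_ball"
    and max\<xi>: "\<And>\<eta>. \<eta> \<in> decreasing_ball \<Longrightarrow> (\<Sum>j. a j * \<eta> j) \<le> (\<Sum>j. a j * \<xi> j)"
    using pairing_attains_max[OF D(6,7)] by blast
  \<comment> \<open>The maximiser restricted to the indices at which \<open>A\<close> has singular
    vectors.\<close>
  define \<zeta> where "\<zeta> j = (if a j \<noteq> 0 then \<xi> j else 0)" for j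
  have pair_\<zeta>: "(\<Sum>j. a j * \<zeta> j) = (\<Sum>j. a j * \<xi> j)"
    by (intro suminf_cong) (simp add: \<zeta>_def)
  have \<zeta>: "\<zeta> \<in> decreasing_ball"
    unfolding decreasing_ball_def
  proof (intro CollectI conjI allI)
    show "0 \<le> \<zeta> j" for j using decreasing_ballD(1)[OF \<xi>] by (simp add: \<zeta>_def)
    \<comment> \<open>The support of the decreasing nonnegative \<open>a\<close> is an initial
      segment, so the cut preserves monotonicity.\<close>
    show "antimono \<zeta>"
    proof (rule antimonoI)
      fix i j :: nat assume "i \<le> j"
      then show "\<zeta> j \<le> \<zeta> i"
        using antimonoD[OF decreasing_ballD(2)[OF \<xi>]] antimonoD[OF D(6)] a_nn[of j]
          decreasing_ballD(1)[OF \<xi>] by (auto simp: \<zeta>_def) (metis order_antisym)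
    qed
    fix n
    have "truncate n \<zeta> = (\<lambda>j. if a j \<noteq> 0 then truncate n \<xi> j else 0)"
      by (auto simp: truncate_def \<zeta>_def)
    then have "\<Phi> (truncate n \<zeta>) \<le> \<Phi> (truncate n \<xi>)"
      using restrict_le[OF truncate_in_c00, of "\<lambda>j. a j \<noteq> 0"] by simp
    then show "\<Phi> (truncate n \<zeta>) \<le> 1" using decreasing_ballD(3)[OF \<xi>, of n] by simp
  qed
  note \<zeta>_nn = decreasing_ballD(1)[OF \<zeta>] and sum_\<zeta> = summable_decreasing_ball[OF \<zeta>]
  \<comment> \<open>Exchanging \<open>u\<close> and \<open>v\<close> makes each trace term equal to
    \<open>a j * \<zeta> j\<close>, without a phase. Zero vectors are put where
    \<open>\<zeta> j = 0\<close>, as a singular decomposition demands.\<close>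
  define e f where "e j = (if \<zeta> j = 0 then 0 else v j)"
    and "f j = (if \<zeta> j = 0 then 0 else u j)" for j
  have uv: "u j \<noteq> 0" "v j \<noteq> 0" if "\<zeta> j \<noteq> 0" for j
    using that D(3,4)[of j] by (auto simp: \<zeta>_def)
  have diag: "diagonal \<zeta> e f"
    using decreasing_ballD(2)[OF \<zeta>] summable_LIMSEQ_zero[OF sum_\<zeta>]
      orthonormal_familyD[OF D(8)] orthonormal_familyD[OF D(9)]
    by unfold_locales
      (auto simp: orthonormal_family_def e_def f_def cinner.zero_left cinner.zero_right)
  let ?K = "diagonal_operator \<zeta> e f"
  have sd: "singular_decomposition ?K \<zeta> e f"
    using uv by (intro singular_decomposition_diagonal_operator[OF diag]) (auto simp: e_def f_def)
  note s = singular_value_eq[OF sd]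
  have K: "trace_class ?K"
    using diagonal.compact_operator_operator[OF diag] sum_\<zeta> s by (simp add: trace_class_def)
  have "\<zeta> j *\<^sub>R cinner (A (f j)) (e j) = complex_of_real (a j * \<zeta> j)" for j
  proof (cases "\<zeta> j = 0")
    case False
    have "cinner (A (u j)) (v j) = complex_of_real (a j)"
      using diagonal.cinner_operator[OF D(1), of "u j" j] D(2) uv[OF False]
        orthonormal_familyD[OF D(8), of j j] by simp
    then show ?thesis using False by (simp add: e_def f_def scaleR_conv_of_real)
  qed simp
  then have "ctrace (A \<circ> ?K) = (\<Sum>j. complex_of_real (a j * \<zeta> j))"
    using ctrace_comp[OF A(2) bounded_clinear_if_compact[OF A(1)] sd sum_\<zeta>] by (simp only:)
  also have "\<dots> = complex_of_real (\<Sum>j. a j * \<zeta> j)"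
    by (rule suminf_of_real[OF summable_pairing[OF \<zeta> D(6,7)], symmetric])
  finally have "cmod (ctrace (A \<circ> ?K)) = \<bar>\<Sum>j. a j * \<zeta> j\<bar>" by (simp only: norm_of_real)
  moreover have "0 \<le> (\<Sum>j. a j * \<zeta> j)"
    using a_nn \<zeta>_nn by (intro suminf_nonneg summable_pairing[OF \<zeta> D(6,7)]) auto
  ultimately have tr: "cmod (ctrace (A \<circ> ?K)) = (\<Sum>j. a j * \<xi> j)" by (simp add: pair_\<zeta>)
  have pos: "0 < (\<Sum>j. a j * \<xi> j)"
  proof -
    \<comment> \<open>The first unit sequence is a competitor with pairing \<open>a 0\<close>, which
      makes the maximum positive.\<close>
    define \<delta> :: "nat \<Rightarrow> real" where "\<delta> j = (if j = 0 then 1 else 0)" for j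
    have "\<Phi> (truncate n \<delta>) \<le> 1" for n
      using truncate_le_sum[of n \<delta>] by (auto simp: \<delta>_def sum.delta split: if_splits)
    then have "\<delta> \<in> decreasing_ball" by (auto simp: decreasing_ball_def \<delta>_def antimono_def)
    then have "(\<Sum>j. a j * \<delta> j) \<le> (\<Sum>j. a j * \<xi> j)" by (rule max\<xi>)
    moreover have "(\<Sum>j. a j * \<delta> j) = (\<Sum>j\<in>{0}. a j * \<delta> j)"
      by (rule suminf_finite) (auto simp: \<delta>_def)
    ultimately show ?thesis using a0 a_nn[of 0] by (simp add: \<delta>_def)
  qed
  define r where "r = sn_norm \<Phi> ?K"
  have le_r: "\<Phi> (truncate n \<zeta>) \<le> r" for n
    using truncate_limit(2)[OF sum_\<zeta> \<zeta>_nn] by (simp add: r_def sn_norm_eq s)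
  have "r \<le> 1"
    using LIMSEQ_le_const2[OF truncate_limit(1)[OF sum_\<zeta> \<zeta>_nn], of 1] decreasing_ballD(3)[OF \<zeta>]
    by (auto simp: r_def sn_norm_eq s)
  have "r > 0"
  proof -
    have "(\<Sum>j. a j * \<zeta> j) \<noteq> 0" using pos unfolding pair_\<zeta> by simp
    then have "(\<lambda>j. a j * \<zeta> j) \<noteq> (\<lambda>_. 0)" by (metis suminf_zero)
    then obtain j where "\<zeta> j \<noteq> 0" unfolding fun_eq_iff by auto
    then have "truncate (Suc j) \<zeta> j \<noteq> 0" by (simp add: truncate_def)
    then have "\<Phi> (truncate (Suc j) \<zeta>) \<noteq> 0" using eq_0_iff[OF truncate_in_c00] by metis
    then show ?thesis using nonneg[OF truncate_in_c00, of "Suc j" \<zeta>] le_r[of "Suc j"] by simp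
  qed
  \<comment> \<open>\<open>r\<close> bounds all truncations of \<zeta>, so division by
    \<open>r\<close> stays in the ball, and maximality with a positive maximum excludes 1/r >
    1.\<close>
  have "r \<ge> 1"
  proof -
    have scaled: "(\<lambda>j. 1 / r * \<zeta> j) \<in> decreasing_ball"
      unfolding decreasing_ball_def
    proof (intro CollectI conjI allI)
      show "0 \<le> 1 / r * \<zeta> j" for j using \<open>r > 0\<close> \<zeta>_nn by simp
      show "antimono (\<lambda>j. 1 / r * \<zeta> j)"
        using antimonoD[OF decreasing_ballD(2)[OF \<zeta>]] \<open>r > 0\<close>
        by (intro antimonoI mult_left_mono) auto
      fix n
      have "truncate n (\<lambda>j. 1 / r * \<zeta> j) = (\<lambda>j. 1 / r * truncate n \<zeta> j)"
        by (auto simp: truncate_def)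
      then have "\<Phi> (truncate n (\<lambda>j. 1 / r * \<zeta> j)) = 1 / r * \<Phi> (truncate n \<zeta>)"
        using scale[OF truncate_in_c00, of "1 / r"] \<open>r > 0\<close> by simp
      then show "\<Phi> (truncate n (\<lambda>j. 1 / r * \<zeta> j)) \<le> 1" using le_r[of n] \<open>r > 0\<close> by simp
    qed
    have "(\<Sum>j. a j * (1 / r * \<zeta> j)) = 1 / r * (\<Sum>j. a j * \<zeta> j)"
      using suminf_mult[OF summable_pairing[OF \<zeta> D(6,7)], of "1 / r"] by (simp add: mult.left_commute)
    then have "1 / r * (\<Sum>j. a j * \<xi> j) \<le> (\<Sum>j. a j * \<xi> j)"
      using max\<xi>[OF scaled] pair_\<zeta> by simp
    then show ?thesis using \<open>r > 0\<close> pos by (simp add: field_simps)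
  qed
  with \<open>r \<le> 1\<close> have "sn_norm \<Phi> ?K = 1" by (simp add: r_def)
  then show ?thesis by (rule dual_norming_if_extremal[OF A K]) (simp add: tr max\<xi>)
qed

end

theorem theorem12p19:
  fixes \<Phi> :: "(nat \<Rightarrow> real) \<Rightarrow> real"
    and T :: "'a::chilbert_space \<Rightarrow> 'a"
  assumes separable: "separable_space (euclidean :: 'a topology)"
    and sn: "sn_function \<Phi>"
    and equiv: "sn_equivalent \<Phi> sn_max"
    and bounded: "bounded_clinear T"
    and compact: "compact_operator T"
  shows "absolutely_dual_norming \<Phi> T"
  unfolding absolutely_dual_norming_def
proof (intro conjI allI impI)
  interpret symmetric_norming_max \<Phi> using sn equiv by unfold_locales
  fix M :: "'a set"
  assume M: "complex_vector.subspace M \<and> closed M \<and> M \<noteq> {0}"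
  \<comment> \<open>This vector spans the line for the rank one projection in the case where the
    composite is zero.\<close>
  then obtain h where "h \<in> M" "h \<noteq> 0" using complex_vector.subspace_0 by blast
  have A: "compact_operator (T \<circ> cprojection M)"
    using M by (intro compact_operator_comp_cprojection[OF compact]) auto
  then obtain a u v where sd: "singular_decomposition (T \<circ> cprojection M) a u v"
    using singular_decomposition_exists by blast
  show "dual_norming \<Phi> (T \<circ> cprojection M)"
    using dual_norming_zero[OF A sd _ \<open>h \<noteq> 0\<close>] dual_norming_nonzero[OF A sd] by blast
qed (rule bounded)

end
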